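(* Let $G$ be a compact and connected Abelian group whose character group $X$ is equipped with a fixed total order compatible with the group structure. Let $(\Omega,\mu)$ be a measure space, $A:\Omega\to\mathrm{Aut}(G)$ a measurable map with $A(u)\in\mathrm{Aut}(G)^+$ for $\mu$-a.e. $u\in\Omega$, and $\Phi$ a locally $\mu$-integrable function on $\Omega$. Let $1\le p\le\infty$. The Hausdorff operator $\mathcal{H}_{\Phi,A}$ is bounded on $H^p(G)$ if and only if $\Phi\in L^1(\mu)$. In this case, $$\|\mathcal{H}_{\Phi,A}\|_{\mathcal{L}(H^p(G))}\le\|\Phi\|_{L^1(\mu)}.$$
   Context: $G$ carries its normalized Haar measure $\nu$. $X$ is the (discrete, multiplicatively written) group of continuous characters of $G$ with unit character $\mathbf 1$, and $X_+=\{\chi\in X:\chi\ge\mathbf 1\}$ is the positive cone, so $X_+$ is a subsemigroup with $X_+^{-1}\cup X_+=X$ and $X_+^{-1}\cap X_+=\{\mathbf 1\}$. $\mathrm{Aut}(G)$ is the group of topological automorphisms of $G$ with its natural topology. For $A\in\mathrm{Aut}(G)$, $A^*\in\mathrm{Aut}(X)$ is $A^*(\chi)=\chi\circ A$. $\mathrm{Aut}_+(X)$ is the set of $\tau\in\mathrm{Aut}(X)$ with $\tau(X_+)\subset X_+$, and $\mathrm{Aut}(G)^+=\{A\in\mathrm{Aut}(G):A^*\in\mathrm{Aut}_+(X)\}$. $H^p(G)=\{f\in L^p(G):\widehat f(\chi)=0\ \forall\chi\in X\setminus X_+\}$ with the $L^p$ norm, where $\widehat f(\chi)=\int_G f\overline\chi\,d\nu$.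 Hausdorff operator: $(\mathcal{H}_{\Phi,A}f)(x)=\int_\Omega\Phi(u)f(A(u)(x))\,d\mu(u)$. That it is bounded on a normed space $Y$ of functions on $G$ means that for each $f\in Y$ the (Lebesgue) integral exists for $\nu$-a.e. $x$ and defines an element of $Y$, and the resulting linear map $Y\to Y$ is bounded. $\mathcal{L}(Y)$ is the space of bounded linear operators on $Y$ with the operator norm.
   Formalization: "Measurable map" A means Borel measurable and, on sets of finite measure, essentially separably valued in the uniform structure of Aut(G); this is automatic for metrizable G, or if no real-valued measurable cardinal exists; if one exists, the claim can fail without it. *)

theory Defs
  imports "HOL-Probability.Probability"
begin

section \<open>Characters and orders on the character group\<close>

text \<open>The group \<open>G\<close> is written additively and is the whole type \<open>'g\<close>; its characters are
  written multiplicatively, as functions into the unit circle of the complex plane.\<close>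

definition characters :: "('g::topological_ab_group_add \<Rightarrow> complex) set" where
  "characters = {\<gamma>. continuous_on UNIV \<gamma> \<and> (\<forall>x. norm (\<gamma> x) = 1) \<and>
                     (\<forall>x y. \<gamma> (x + y) = \<gamma> x * \<gamma> y)}"

text \<open>An order is a relation, with \<open>(\<gamma>, \<psi>) \<in> r\<close> meaning \<open>\<gamma> \<le> \<psi>\<close>.\<close>

definition character_order ::
  "(('g::topological_ab_group_add \<Rightarrow> complex) \<times> ('g \<Rightarrow> complex)) set \<Rightarrow> bool" where
  "character_order r \<longleftrightarrow> linear_order_on characters r \<and>
     (\<forall>\<gamma> \<psi>. \<forall>\<xi>\<in>characters. (\<gamma>, \<psi>) \<in> r \<longrightarrow> ((\<lambda>x. \<gamma> x * \<xi> x), (\<lambda>x. \<psi> x * \<xi> x)) \<in> r)"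

definition positive_cone ::
  "(('g::topological_ab_group_add \<Rightarrow> complex) \<times> ('g \<Rightarrow> complex)) set \<Rightarrow> ('g \<Rightarrow> complex) set" where
  "positive_cone r = {\<gamma> \<in> characters. ((\<lambda>_. 1), \<gamma>) \<in> r}"

section \<open>Automorphisms\<close>

definition top_auts :: "('g::topological_ab_group_add \<Rightarrow> 'g) set" where
  "top_auts = {B. bij B \<and> (\<forall>x y. B (x + y) = B x + B y) \<and>
                  continuous_on UNIV B \<and> continuous_on UNIV (inv B)}"

definition dual_map :: "('g \<Rightarrow> 'g) \<Rightarrow> ('g \<Rightarrow> complex) \<Rightarrow> ('g \<Rightarrow> complex)" where
  "dual_map B = (\<lambda>\<gamma>. \<gamma> \<circ> B)"

definition character_auts_plus ::
  "(('g::topological_ab_group_add \<Rightarrow> complex) \<times> ('g \<Rightarrow> complex)) set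
     \<Rightarrow> (('g \<Rightarrow> complex) \<Rightarrow> ('g \<Rightarrow> complex)) set" where
  "character_auts_plus r = {\<tau>. bij_betw \<tau> characters characters \<and>
     (\<forall>\<gamma>\<in>characters. \<forall>\<psi>\<in>characters. \<tau> (\<lambda>x. \<gamma> x * \<psi> x) = (\<lambda>x. \<tau> \<gamma> x * \<tau> \<psi> x)) \<and>
     \<tau> ` positive_cone r \<subseteq> positive_cone r}"

definition top_auts_plus ::
  "(('g::topological_ab_group_add \<Rightarrow> complex) \<times> ('g \<Rightarrow> complex)) set \<Rightarrow> ('g \<Rightarrow> 'g) set" where
  "top_auts_plus r = {B \<in> top_auts. dual_map B \<in> character_auts_plus r}"

text \<open>The usual topology of the automorphism group: the compact-open topology made symmetric
  under inversion. For compact \<open>G\<close> it is the topology of uniform convergence.\<close>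

definition aut_topology :: "('g::topological_ab_group_add \<Rightarrow> 'g) topology" where
  "aut_topology = topology_generated_by
     ({{B \<in> top_auts. B ` K \<subseteq> U} |K U. compact K \<and> open U} \<union>
      {{B \<in> top_auts. inv B ` K \<subseteq> U} |K U. compact K \<and> open U})"

definition aut_borel :: "('g::topological_ab_group_add \<Rightarrow> 'g) measure" where
  "aut_borel = sigma top_auts {S. openin aut_topology S}"

text \<open>Measurability of a map into the automorphism group is strong measurability: the map is Borel
  measurable and, on each set of finite measure, essentially separably valued for the uniform
  structure (up to any neighbourhood \<open>W\<close> of \<open>0\<close>, countably many automorphisms suffice). The second
  clause is automatic if \<open>G\<close> is second countable (see \<open>aut_measurable_iff\<close> below). For general
  \<open>G\<close>, Borel measurability implies it unless there are real-valued measurable cardinals. In that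
  case Borel measurability alone does not make the orbit integrals of an integrable function
  measurable.\<close>

definition aut_measurable ::
  "'w measure \<Rightarrow> ('w \<Rightarrow> 'g::topological_ab_group_add \<Rightarrow> 'g) \<Rightarrow> bool" where
  "aut_measurable M A \<longleftrightarrow> A \<in> M \<rightarrow>\<^sub>M aut_borel \<and>
     (\<forall>E\<in>sets M. emeasure M E < \<infinity> \<longrightarrow> (\<forall>W. open W \<and> 0 \<in> W \<longrightarrow>
        (\<exists>D\<subseteq>top_auts. countable D \<and>
           (AE u in M. u \<in> E \<longrightarrow> (\<exists>B\<in>D. \<forall>x. A u x - B x \<in> W)))))"

section \<open>Haar measure and function spaces\<close>

definition normalized_haar :: "'g::topological_ab_group_add measure \<Rightarrow> bool" where
  "normalized_haar \<nu> \<longleftrightarrow> prob_space \<nu> \<and> sets \<nu> = sets borel \<and>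
     (\<forall>a. distr \<nu> borel (\<lambda>x. a + x) = \<nu>) \<and>
     (\<forall>B\<in>sets borel. emeasure \<nu> B = (SUP K\<in>{K. compact K \<and> K \<subseteq> B}. emeasure \<nu> K))"

text \<open>Elements of \<open>L\<^sup>p\<close> are given by Borel representatives. The norm is therefore a seminorm that
  vanishes exactly on null functions.\<close>

definition Lp_set :: "ennreal \<Rightarrow> 'a measure \<Rightarrow> ('a \<Rightarrow> complex) set" where
  "Lp_set p M = {f \<in> borel_measurable M.
     if p = \<infinity> then esssup M (\<lambda>x. ereal (norm (f x))) < \<infinity>
     else integrable M (\<lambda>x. norm (f x) powr enn2real p)}"

definition Lp_norm :: "ennreal \<Rightarrow> 'a measure \<Rightarrow> ('a \<Rightarrow> complex) \<Rightarrow> real" where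
  "Lp_norm p M f =
     (if p = \<infinity> then real_of_ereal (esssup M (\<lambda>x. ereal (norm (f x))))
      else (LINT x|M. norm (f x) powr enn2real p) powr (1 / enn2real p))"

definition fourier_coeff ::
  "'g::topological_ab_group_add measure \<Rightarrow> ('g \<Rightarrow> complex) \<Rightarrow> ('g \<Rightarrow> complex) \<Rightarrow> complex" where
  "fourier_coeff \<nu> f \<gamma> = (LINT x|\<nu>. f x * cnj (\<gamma> x))"

definition Hp_set ::
  "ennreal \<Rightarrow> 'g::topological_ab_group_add measure
     \<Rightarrow> (('g \<Rightarrow> complex) \<times> ('g \<Rightarrow> complex)) set \<Rightarrow> ('g \<Rightarrow> complex) set" where
  "Hp_set p \<nu> r = {f \<in> Lp_set p \<nu>. \<forall>\<gamma>\<in>characters - positive_cone r. fourier_coeff \<nu> f \<gamma> = 0}"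

section \<open>Hausdorff operators\<close>

text \<open>On an abstract measure space, local integrability refers to the sets of finite measure.\<close>

definition locally_integrable :: "'w measure \<Rightarrow> ('w \<Rightarrow> complex) \<Rightarrow> bool" where
  "locally_integrable M \<Phi> \<longleftrightarrow> \<Phi> \<in> borel_measurable M \<and>
     (\<forall>E\<in>sets M. emeasure M E < \<infinity> \<longrightarrow> set_integrable M E \<Phi>)"

definition hausdorff_op ::
  "'w measure \<Rightarrow> ('w \<Rightarrow> complex) \<Rightarrow> ('w \<Rightarrow> 'g \<Rightarrow> 'g) \<Rightarrow> ('g \<Rightarrow> complex) \<Rightarrow> 'g \<Rightarrow> complex" where
  "hausdorff_op M \<Phi> A f x = (LINT u|M. \<Phi> u * f (A u x))"

text \<open>\<open>g\<close> is a representative of the image of \<open>f\<close>: the integral exists and equals \<open>g\<close> almost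
  everywhere. (The Bochner integral is \<open>0\<close> by convention where the integrand is not integrable, so
  existence has to be required separately.)\<close>

definition hausdorff_image ::
  "'g measure \<Rightarrow> 'w measure \<Rightarrow> ('w \<Rightarrow> complex) \<Rightarrow> ('w \<Rightarrow> 'g \<Rightarrow> 'g)
     \<Rightarrow> ('g \<Rightarrow> complex) \<Rightarrow> ('g \<Rightarrow> complex) \<Rightarrow> bool" where
  "hausdorff_image \<nu> M \<Phi> A f g \<longleftrightarrow>
     (AE x in \<nu>. integrable M (\<lambda>u. \<Phi> u * f (A u x)) \<and> g x = hausdorff_op M \<Phi> A f x)"

text \<open>The bound in the second clause also makes the operator well defined on classes of almost
  everywhere equal functions.\<close>

definition hausdorff_bounded ::
  "'g measure \<Rightarrow> 'w measure \<Rightarrow> ('w \<Rightarrow> complex) \<Rightarrow> ('w \<Rightarrow> 'g \<Rightarrow> 'g)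
     \<Rightarrow> ('g \<Rightarrow> complex) set \<Rightarrow> (('g \<Rightarrow> complex) \<Rightarrow> real) \<Rightarrow> bool" where
  "hausdorff_bounded \<nu> M \<Phi> A Y N \<longleftrightarrow>
     (\<forall>f\<in>Y. \<exists>g\<in>Y. hausdorff_image \<nu> M \<Phi> A f g) \<and>
     (\<exists>C. \<forall>f\<in>Y. \<forall>g\<in>Y. hausdorff_image \<nu> M \<Phi> A f g \<longrightarrow> N g \<le> C * N f)"

definition hausdorff_norm ::
  "'g measure \<Rightarrow> 'w measure \<Rightarrow> ('w \<Rightarrow> complex) \<Rightarrow> ('w \<Rightarrow> 'g \<Rightarrow> 'g)
     \<Rightarrow> ('g \<Rightarrow> complex) set \<Rightarrow> (('g \<Rightarrow> complex) \<Rightarrow> real) \<Rightarrow> real" where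
  "hausdorff_norm \<nu> M \<Phi> A Y N =
     Sup {N g |f g. f \<in> Y \<and> g \<in> Y \<and> N f \<le> 1 \<and> hausdorff_image \<nu> M \<Phi> A f g}"

section \<open>Strong and Borel measurability agree for second countable groups\<close>

lemma zero_nbhd_half:
  fixes W :: "'g::topological_ab_group_add set"
  assumes "open W" "0 \<in> W"
  shows "\<exists>V. open V \<and> 0 \<in> V \<and> (\<forall>a\<in>V. \<forall>b\<in>V. a - b \<in> W) \<and> (\<forall>a\<in>V. \<forall>b\<in>V. a + b \<in> W)"
proof -
  have d: "((\<lambda>z::'g\<times>'g. fst z - snd z) \<longlongrightarrow> 0 - 0) (nhds 0 \<times>\<^sub>F nhds 0)"
    by (intro tendsto_diff filterlim_fst filterlim_snd)
  have s: "((\<lambda>z::'g\<times>'g. fst z + snd z) \<longlongrightarrow> 0 + 0) (nhds 0 \<times>\<^sub>F nhds 0)"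
    by (intro tendsto_add filterlim_fst filterlim_snd)
  have "\<forall>\<^sub>F z in nhds (0::'g) \<times>\<^sub>F nhds 0. fst z - snd z \<in> W \<and> fst z + snd z \<in> W"
    using topological_tendstoD[OF d, of W] topological_tendstoD[OF s, of W] assms
    by (simp add: eventually_conj_iff)
  then obtain P Q where PQ: "eventually P (nhds (0::'g))" "eventually Q (nhds (0::'g))"
     "\<And>x y. P x \<Longrightarrow> Q y \<Longrightarrow> x - y \<in> W \<and> x + y \<in> W"
    unfolding eventually_prod_filter by auto
  obtain S where S: "open S" "0 \<in> S" "\<And>x. x \<in> S \<Longrightarrow> P x"
    using PQ(1) unfolding eventually_nhds by blast
  obtain T where T: "open T" "0 \<in> T" "\<And>x. x \<in> T \<Longrightarrow> Q x"
    using PQ(2) unfolding eventually_nhds by blast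
  show ?thesis
    using S T PQ(3) by (intro exI[of _ "S \<inter> T"]) auto
qed

lemma open_translate:
  fixes V :: "'g::topological_ab_group_add set"
  assumes "open V"
  shows "open {x. x - d \<in> V}"
proof -
  have "open ((\<lambda>x. x - d) -` V)"
    by (rule open_vimage[OF assms]) (intro continuous_intros)
  then show ?thesis by (simp add: vimage_def)
qed

lemma finite_translates_cover:
  fixes V :: "'g::topological_ab_group_add set"
  assumes "compact (UNIV :: 'g set)" "open V" "0 \<in> V"
  shows "\<exists>F. finite F \<and> (\<forall>x. \<exists>d\<in>F. x - d \<in> V)"
proof -
  have "UNIV \<subseteq> (\<Union>d\<in>(UNIV::'g set). {x. x - d \<in> V})"
    using assms(3) by (auto intro!: exI[of _ "_ :: 'g"])
  then obtain F where "finite F" "UNIV \<subseteq> (\<Union>d\<in>F. {x. x - d \<in> V})"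
    using compactE_image[OF assms(1), of UNIV "\<lambda>d. {x. x - d \<in> V}"]
      open_translate[OF assms(2)] by (metis (no_types, lifting) UNIV_I)
  then show ?thesis by (intro exI[of _ F]) auto
qed

lemma top_auts_countable_net:
  fixes W :: "'g::{topological_ab_group_add,second_countable_topology} set"
  assumes cpt: "compact (UNIV :: 'g set)" and W: "open W" "0 \<in> W"
  shows "\<exists>D\<subseteq>top_auts. countable D \<and> (\<forall>A\<in>top_auts. \<exists>B\<in>D. \<forall>x. A x - B x \<in> W)"
proof -
  obtain V where V: "open V" "0 \<in> V" "\<And>a b. a \<in> V \<Longrightarrow> b \<in> V \<Longrightarrow> a + b \<in> W"
    using zero_nbhd_half[OF W] by blast
  obtain U where U: "open U" "0 \<in> U" "\<And>a b. a \<in> U \<Longrightarrow> b \<in> U \<Longrightarrow> a - b \<in> V"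
    using zero_nbhd_half[OF V(1,2)] by blast
  obtain J where J: "finite J" "\<And>x. \<exists>d\<in>J. x - d \<in> U"
    using finite_translates_cover[OF cpt U(1,2)] by blast
  obtain \<B> :: "'g set set" where \<B>: "countable \<B>" "topological_basis \<B>"
    using ex_countable_basis by blast
  have "\<forall>b. \<exists>F. open b \<and> 0 \<in> b \<longrightarrow> finite F \<and> (\<forall>x::'g. \<exists>d\<in>F. x - d \<in> b)"
    using finite_translates_cover[OF cpt] by blast
  then obtain F where F: "\<And>b. open b \<Longrightarrow> 0 \<in> b \<Longrightarrow> finite (F b) \<and> (\<forall>x::'g. \<exists>d\<in>F b. x - d \<in> b)"
    by metis
  define near where "near b h = {B \<in> top_auts. (\<forall>x\<in>b. B x \<in> U) \<and> (\<forall>y\<in>F b. B y - h y \<in> U)}"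
    for b and h :: "'g \<Rightarrow> 'g"
  define \<C> where "\<C> = (SIGMA b:{b\<in>\<B>. 0 \<in> b}. F b \<rightarrow>\<^sub>E J)"
  define pick where "pick c = (SOME B. B \<in> near (fst c) (snd c))" for c
  define D where "D = pick ` {c \<in> \<C>. near (fst c) (snd c) \<noteq> {}}"
  have b_open: "open b" if "b \<in> \<B>" for b
    using \<B>(2) that by (rule topological_basis_open)
  have "countable \<C>"
    unfolding \<C>_def
    by (intro countable_SIGMA countable_subset[OF _ \<B>(1)] countable_finite finite_PiE)
       (use F b_open J in auto)
  then have "countable D"
    unfolding D_def by (auto intro: countable_subset)
  moreover have pick_near: "pick c \<in> near (fst c) (snd c)" if "near (fst c) (snd c) \<noteq> {}" for c
    unfolding pick_def using that by (intro someI_ex[of "\<lambda>B. B \<in> _"]) auto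
  have "D \<subseteq> top_auts"
    unfolding D_def using pick_near by (auto simp: near_def)
  moreover have "\<exists>B\<in>D. \<forall>x. A x - B x \<in> W" if A: "A \<in> top_auts" for A
  proof -
    have add: "A (x + y) = A x + A y" for x y using A by (simp add: top_auts_def)
    have A0: "A 0 = 0" using add[of 0 0] by simp
    have "open (A -` U)"
      using A U(1) by (auto simp: top_auts_def intro: open_vimage)
    moreover have "0 \<in> A -` U" using A0 U by simp
    ultimately obtain b where b: "b \<in> \<B>" "0 \<in> b" "b \<subseteq> A -` U"
      using topological_basisE[OF \<B>(2)] by metis
    obtain h0 where h0: "\<And>y. h0 y \<in> J \<and> A y - h0 y \<in> U"
      using choice[of "\<lambda>y d. d \<in> J \<and> A y - d \<in> U"] J(2) by blast
    define h where "h = restrict h0 (F b)"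
    have c: "(b, h) \<in> \<C>" unfolding \<C>_def h_def using b h0 by auto
    have An: "A \<in> near b h" unfolding near_def h_def using A b h0 by auto
    define B where "B = pick (b, h)"
    have BD: "B \<in> D" unfolding D_def B_def using c An by auto
    have Bn: "B \<in> near b h" using pick_near[of "(b,h)"] An unfolding B_def by auto
    have "A x - B x \<in> W" for x
    proof -
      obtain d where d: "d \<in> F b" "x - d \<in> b" using F[OF b_open[OF b(1)] b(2)] by blast
      have Badd: "B (y + z) = B y + B z" for y z using Bn by (simp add: near_def top_auts_def)
      have "A x - B x = (A (d + (x - d)) - B (d + (x - d)))" by simp
      also have "\<dots> = ((A d - h d) - (B d - h d)) + (A (x - d) - B (x - d))"
        unfolding add Badd by (simp add: algebra_simps)
      also have "\<dots> \<in> W"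
        using An Bn d unfolding near_def by (intro V(3) U(3)) auto
      finally show ?thesis .
    qed
    then show ?thesis using BD by blast
  qed
  ultimately show ?thesis by blast
qed

lemma aut_topology_space: "openin aut_topology S \<Longrightarrow> S \<subseteq> top_auts"
  by (drule openin_subset) (auto simp: aut_topology_def)

lemma space_aut_borel [simp]: "space aut_borel = top_auts"
  unfolding aut_borel_def using aut_topology_space by (intro space_measure_of) auto

lemma aut_measurable_iff:
  fixes A :: "'w \<Rightarrow> 'g::{topological_ab_group_add,second_countable_topology} \<Rightarrow> 'g"
  assumes "compact (UNIV :: 'g set)"
  shows "aut_measurable M A \<longleftrightarrow> A \<in> M \<rightarrow>\<^sub>M aut_borel"
proof
  assume A: "A \<in> M \<rightarrow>\<^sub>M aut_borel"
  have "\<exists>D\<subseteq>top_auts. countable D \<and> (AE u in M. u \<in> E \<longrightarrow> (\<exists>B\<in>D. \<forall>x. A u x - B x \<in> W))"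
    if W: "open W" "0 \<in> W" for E and W :: "'g set"
  proof -
    obtain D where D: "D \<subseteq> top_auts" "countable D"
       "\<And>B. B \<in> top_auts \<Longrightarrow> \<exists>B'\<in>D. \<forall>x. B x - B' x \<in> W"
      using top_auts_countable_net[OF assms W] by blast
    have "AE u in M. u \<in> E \<longrightarrow> (\<exists>B\<in>D. \<forall>x. A u x - B x \<in> W)"
      using measurable_space[OF A] D(3) by (intro AE_I2) auto
    with D show ?thesis by blast
  qed
  with A show "aut_measurable M A" unfolding aut_measurable_def by blast
qed (simp add: aut_measurable_def)

end

theory Submission
  imports Defs
begin

text \<open>Necessity is seen on the constant function \<open>1\<close>: it lies in \<open>H\<^sup>p\<close>, because a nontrivial
  character has mean \<open>0\<close>, and the integral defining its image at any point is the integral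
  of \<open>\<Phi>\<close>.

  For sufficiency, let \<open>m\<close> be the finite measure with density \<open>|\<Phi>|\<close>. The image of \<open>f\<close> is the average
  over \<open>m\<close> of the functions \<open>f \<circ> A(u)\<close> with the unimodular weights \<open>sgn \<Phi>(u)\<close>. Each \<open>A(u)\<close>
  preserves Haar measure, so \<open>f \<circ> A(u)\<close> has the same \<open>L\<^sup>p\<close> norm as \<open>f\<close>, and Jensen's inequality with
  Tonelli's theorem bounds the norm of the average by \<open>m(\<Omega>) \<parallel>f\<parallel>\<close>. If \<open>\<gamma>\<close> is not positive, then
  \<open>\<gamma> = \<psi> \<circ> A(u)\<close> for a character \<open>\<psi>\<close> that is not positive either; hence the coefficient of
  \<open>f \<circ> A(u)\<close> at \<open>\<gamma>\<close> is that of \<open>f\<close> at \<open>\<psi>\<close>, which is \<open>0\<close>, and Fubini's theorem gives the same for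
  the average.

  The difficulty is measurability. The group need not be second countable, so \<open>(u, x) \<mapsto> A(u)(x)\<close>
  need not be measurable from the product \<open>\<sigma>\<close>-algebra to the Borel sets, and Fubini's theorem does
  not apply to \<open>f(A(u)(x))\<close> as it stands. The map is, however, measurable for the completion of
  \<open>m \<Otimes> \<nu>\<close> (\<open>map_completion_measurable\<close>), so \<open>f(A(u)(x))\<close> agrees almost everywhere with a product
  measurable function, to which the classical theorems apply. Two facts make this work. For
  continuous \<open>f\<close>, strong measurability of \<open>A\<close> approximates \<open>f(A(u)(x))\<close> uniformly by functions that
  depend on \<open>u\<close> through countably many choices (\<open>continuous_compose_ae_product_measurable\<close>). And every open set
  lies in an open set \<open>{\<phi> > 0}\<close>, with \<open>\<phi>\<close> continuous, of the same Haar measure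
  (\<open>open_cozero_hull\<close>, a form of the Kakutani-Kodaira theorem on the completion regularity of Haar
  measure); this passes from continuous functions to all Borel sets.

  That automorphisms preserve \<open>\<nu>\<close> is the uniqueness of Haar measure (\<open>haar_unique\<close>). Its usual proof
  by Fubini's theorem meets the same measurability problem for addition on \<open>G \<times> G\<close>, which is
  resolved by the same argument, applied to the family of translations.\<close>

section \<open>Uniform continuity and separation on compact groups\<close>

lemma continuous_real_uniform_nbhd:
  fixes f :: "'g::topological_ab_group_add \<Rightarrow> real"
  assumes cpt: "compact (UNIV :: 'g set)" and f: "continuous_on UNIV f" and "0 < e"
  shows "\<exists>W. open W \<and> 0 \<in> W \<and> (\<forall>a b. a - b \<in> W \<longrightarrow> \<bar>f a - f b\<bar> < e)"
proof -
  have "continuous_on UNIV (\<lambda>z::'g \<times> 'g. \<bar>f (fst z + snd z) - f (snd z)\<bar>)"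
    by (intro continuous_intros continuous_on_compose2[OF f]) auto
  then have "open ((\<lambda>z::'g \<times> 'g. \<bar>f (fst z + snd z) - f (snd z)\<bar>) -` {..<e})"
    by (intro open_vimage) auto
  moreover have "{0} \<times> UNIV \<subseteq> (\<lambda>z::'g \<times> 'g. \<bar>f (fst z + snd z) - f (snd z)\<bar>) -` {..<e}"
    using \<open>0 < e\<close> by auto
  ultimately have "\<exists>W. 0 \<in> W \<and> open W \<and>
      W \<times> UNIV \<subseteq> (\<lambda>z::'g \<times> 'g. \<bar>f (fst z + snd z) - f (snd z)\<bar>) -` {..<e}"
    by (rule Elementary_Topology.tube_lemma[OF cpt])
  then obtain W where W: "0 \<in> W" "open W"
      "W \<times> UNIV \<subseteq> (\<lambda>z::'g \<times> 'g. \<bar>f (fst z + snd z) - f (snd z)\<bar>) -` {..<e}"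
    by blast
  (* The pair (a - b, b) is sent to the difference f a - f b. *)
  have "\<bar>f a - f b\<bar> < e" if "a - b \<in> W" for a b
    using subsetD[OF W(3), of "(a - b, b)"] that by auto
  with W show ?thesis by blast
qed

lemma compact_open_separating_function:
  fixes K U :: "'g::t2_space set"
  assumes cpt: "compact (UNIV :: 'g set)" and K: "compact K" "open U" "K \<subseteq> U"
  shows "\<exists>f :: 'g \<Rightarrow> real. continuous_on UNIV f \<and> (\<forall>x. 0 \<le> f x \<and> f x \<le> 1) \<and>
           (\<forall>x\<in>K. f x = 1) \<and> (\<forall>x. x \<notin> U \<longrightarrow> f x = 0)"
proof -
  have "normal_space (euclidean :: 'g topology)"
  proof (rule compact_Hausdorff_or_regular_imp_normal_space)
    show "compact_space (euclidean :: 'g topology)"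
      using cpt by (simp add: compact_space_def)
    show "Hausdorff_space (euclidean :: 'g topology) \<or> regular_space (euclidean :: 'g topology)"
      by (rule disjI1) (simp add: Hausdorff_space_def disjnt_def, intro allI impI, drule hausdorff, blast)
  qed
  moreover have "closedin euclidean (- U)" "closedin euclidean K" "disjnt (- U) K"
    using K compact_imp_closed by (auto simp: disjnt_def)
  ultimately obtain f where f: "continuous_map euclidean (top_of_set {0..1::real}) f"
      "f ` (- U) \<subseteq> {0}" "f ` K \<subseteq> {1}"
    using Urysohn_lemma[of euclidean "- U" K 0 1] by auto
  then have "continuous_on UNIV f" "\<And>x. f x \<in> {0..1}"
    by (auto simp: continuous_map_in_subtopology)
  with f show ?thesis by (intro exI[of _ f]) auto
qed

section \<open>Cozero sets and completion regularity of Haar measure\<close>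
locale compact_haar = prob_space \<nu>
  for \<nu> :: "'g::{topological_ab_group_add,t2_space} measure" +
  assumes cpt: "compact (UNIV :: 'g set)"
    and sets_haar [simp, measurable_cong]: "sets \<nu> = sets borel"
    and translation: "distr \<nu> borel (\<lambda>x. a + x) = \<nu>"
    and inner_regular:
      "B \<in> sets borel \<Longrightarrow> emeasure \<nu> B = (SUP K\<in>{K. compact K \<and> K \<subseteq> B}. emeasure \<nu> K)"
begin

lemma space_haar [simp]: "space \<nu> = UNIV"
  using sets_eq_imp_space_eq[OF sets_haar] by simp

lemma closed_compact: "closed (K :: 'g set) \<Longrightarrow> compact K"
  using compact_Int_closed[OF cpt, of K] by simp

lemma borel_set [simp]: "compact (K :: 'g set) \<Longrightarrow> K \<in> sets borel"
  by (simp add: borel_closed compact_imp_closed)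

lemma translation_measurable [measurable]: "(\<lambda>x::'g. a + x) \<in> borel \<rightarrow>\<^sub>M borel"
  by (intro borel_measurable_continuous_onI continuous_intros)

lemma emeasure_translate:
  assumes "S \<in> sets borel"
  shows "emeasure \<nu> {x. a + x \<in> S} = emeasure \<nu> S"
proof -
  have "emeasure \<nu> S = emeasure (distr \<nu> borel (\<lambda>x. a + x)) S" by (simp add: translation)
  also have "\<dots> = emeasure \<nu> {x. a + x \<in> S}"
    using assms by (subst emeasure_distr) (auto simp: vimage_def)
  finally show ?thesis by simp
qed

text \<open>By inner regularity, this replaces countable subadditivity when a set has an uncountable open
  cover with null members: a compact subset needs only finitely many of them.\<close>
lemma null_if_compact_null:
  assumes "B \<in> sets borel" "\<And>K. compact K \<Longrightarrow> K \<subseteq> B \<Longrightarrow> emeasure \<nu> K = 0"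
  shows "emeasure \<nu> B = 0"
  using assms by (subst inner_regular) (auto intro!: SUP_eqI)

lemma outer_regular:
  assumes B: "B \<in> sets borel" and "0 < e"
  obtains U where "open U" "B \<subseteq> U" "emeasure \<nu> (U - B) < ennreal e"
proof -
  have B': "- B \<in> sets borel" using B by auto
  have e: "measure \<nu> (- B) - e < measure \<nu> (- B)" using \<open>0 < e\<close> by simp
  have "\<exists>K. compact K \<and> K \<subseteq> - B \<and> measure \<nu> (- B) - e < measure \<nu> K"
  proof (cases "measure \<nu> (- B) - e < 0")
    case True
    then show ?thesis by (intro exI[of _ "{}"]) auto
  next
    case False
    then have "ennreal (measure \<nu> (- B) - e) < emeasure \<nu> (- B)"
      using e by (simp add: emeasure_eq_measure ennreal_lessI)
    then obtain K where K: "compact K" "K \<subseteq> - B" "ennreal (measure \<nu> (- B) - e) < emeasure \<nu> K"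
      unfolding inner_regular[OF B'] less_SUP_iff by auto
    then show ?thesis using False
      by (intro exI[of _ K]) (auto simp: emeasure_eq_measure ennreal_less_iff)
  qed
  then obtain K where K: "compact K" "K \<subseteq> - B" "measure \<nu> (- B) - e < measure \<nu> K" by blast
  have "- K - B = - B - K" by auto
  then have "measure \<nu> (- K - B) = measure \<nu> (- B) - measure \<nu> K"
    using K B B' by (simp add: finite_measure_Diff)
  then have "emeasure \<nu> (- K - B) < ennreal e"
    using K \<open>0 < e\<close> by (simp add: emeasure_eq_measure ennreal_lessI)
  moreover have "open (- K)" "B \<subseteq> - K" using K compact_imp_closed by auto
  ultimately show ?thesis using that by blast
qed

text \<open>Inner regularity exhausts the open set, up to a null set, by a sequence of compact sets; a
  weighted sum of functions separating them from the complement is positive on all of them.\<close>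
lemma open_ae_cozero_subset:
  assumes U: "open U"
  shows "\<exists>f :: 'g \<Rightarrow> real. continuous_on UNIV f \<and> {x. f x > 0} \<subseteq> U \<and> emeasure \<nu> (U - {x. f x > 0}) = 0"
proof -
  have "\<exists>K. compact K \<and> K \<subseteq> U \<and> emeasure \<nu> (U - K) \<le> ennreal (inverse (Suc n))" for n
  proof -
    obtain V where V: "open V" "- U \<subseteq> V" "emeasure \<nu> (V - (- U)) < ennreal (inverse (Suc n))"
      using outer_regular[of "- U" "inverse (Suc n)"] U by auto
    have "V - (- U) = U - (- V)" by auto
    then show ?thesis
      using V by (intro exI[of _ "- V"]) (auto intro!: closed_compact)
  qed
  then obtain K where K: "\<And>n. compact (K n)" "\<And>n. K n \<subseteq> U"
      "\<And>n. emeasure \<nu> (U - K n) \<le> ennreal (inverse (Suc n))" by metis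
  have "\<forall>n. \<exists>f. continuous_on UNIV f \<and> (\<forall>x. 0 \<le> f x \<and> f x \<le> (1::real)) \<and>
           (\<forall>x\<in>K n. f x = 1) \<and> (\<forall>x. x \<notin> U \<longrightarrow> f x = 0)"
    using compact_open_separating_function[OF cpt K(1) U K(2)] by blast
  then obtain F :: "nat \<Rightarrow> 'g \<Rightarrow> real" where F: "\<And>n. continuous_on UNIV (F n)"
     "\<And>n x. 0 \<le> F n x" "\<And>n x. F n x \<le> 1" "\<And>n x. x \<in> K n \<Longrightarrow> F n x = 1" "\<And>n x. x \<notin> U \<Longrightarrow> F n x = 0"
    by metis
  define f where "f x = (\<Sum>n. (1/2)^n * F n x)" for x
  have geo: "summable (\<lambda>n. (1/2::real)^n)" by (intro summable_geometric) auto
  have bnd: "norm ((1/2)^n * F n x) \<le> (1/2)^n" for n x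
    using F(2)[of n x] F(3)[of n x] by (auto simp: mult_left_le)
  have smb: "summable (\<lambda>n. (1/2)^n * F n x)" for x
    by (rule summable_comparison_test'[OF geo, of 0]) (rule bnd)
  have "uniform_limit UNIV (\<lambda>n x. \<Sum>i<n. (1/2)^i * F i x) f sequentially"
    unfolding f_def using bnd geo by (intro Weierstrass_m_test) auto
  then have cont: "continuous_on UNIV f"
    by (rule uniform_limit_theorem[rotated]) (auto intro!: always_eventually continuous_intros F(1))
  have pos: "f x > 0 \<longleftrightarrow> (\<exists>n. F n x \<noteq> 0)" for x
  proof -
    have nz: "F n x \<noteq> 0 \<longleftrightarrow> 0 < (1/2)^n * F n x" for n
      using F(2)[of n x] by auto
    have "\<And>n. 0 \<le> (1/2)^n * F n x" using F(2) by simp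
    from suminf_pos_iff[OF smb[of x] this] show ?thesis unfolding f_def nz .
  qed
  have sub: "{x. f x > 0} \<subseteq> U"
  proof
    fix x assume "x \<in> {x. f x > 0}"
    then obtain n where "F n x \<noteq> 0" using pos[of x] by blast
    then show "x \<in> U" using F(5)[of x n] by blast
  qed
  have "measure \<nu> (U - {x. f x > 0}) \<le> inverse (real (Suc n))" for n
  proof -
    have "U - {x. f x > 0} \<subseteq> U - K n"
    proof (intro Diff_mono subset_refl subsetI)
      fix x assume "x \<in> K n"
      then have "F n x \<noteq> 0" using F(4)[of x n] by simp
      then show "x \<in> {x. f x > 0}" using pos[of x] by blast
    qed
    then have "emeasure \<nu> (U - {x. f x > 0}) \<le> emeasure \<nu> (U - K n)"
      using borel_open[OF U] borel_set[OF K(1)[of n]] by (intro emeasure_mono) auto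
    then have "emeasure \<nu> (U - {x. f x > 0}) \<le> ennreal (inverse (Suc n))"
      using K(3)[of n] by (rule order_trans)
    then show ?thesis by (simp add: emeasure_eq_measure)
  qed
  then have "measure \<nu> (U - {x. f x > 0}) \<le> 0"
    by (intro LIMSEQ_le_const[OF LIMSEQ_inverse_real_of_nat]) blast
  then have "emeasure \<nu> (U - {x. f x > 0}) = 0"
    by (simp add: emeasure_eq_measure measure_le_0_iff)
  then show ?thesis using cont sub by blast
qed

text \<open>Start with a cozero set \<open>V = {f > 0}\<close> inside \<open>U\<close> of the same measure, and let \<open>H\<close> be the group of
  periods of \<open>f\<close>. The open set \<open>S = U + H\<close> exceeds \<open>V\<close> only by a null set: a compact subset of
  \<open>S - V\<close> is covered by finitely many translates of the null set \<open>U - V\<close>, since \<open>V\<close> is invariant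
  under \<open>H\<close>. Moreover \<open>S\<close> is again a cozero set, because \<open>S\<close> is a union of classes of the continuous
  pseudometric \<open>d\<close> given by the sup distance of translates of \<open>f\<close>, for which two points are at
  distance \<open>0\<close> exactly if they differ by a period; the distance to the complement of \<open>S\<close> is
  therefore positive on \<open>S\<close>.\<close>
lemma open_cozero_hull:
  assumes U: "open U"
  shows "\<exists>\<phi> :: 'g \<Rightarrow> real. continuous_on UNIV \<phi> \<and> U \<subseteq> {x. \<phi> x > 0} \<and> emeasure \<nu> ({x. \<phi> x > 0} - U) = 0"
proof -
  obtain f :: "'g \<Rightarrow> real" where f: "continuous_on UNIV f" "{x. f x > 0} \<subseteq> U"
      "emeasure \<nu> (U - {x. f x > 0}) = 0"
    using open_ae_cozero_subset[OF U] by blast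
  define V where "V = {x. f x > 0}"
  have oV: "open V" unfolding V_def by (intro open_Collect_less f continuous_intros)
  define H where "H = {h. \<forall>z. f (h + z) = f z}"
  define S where "S = (\<Union>h\<in>H. {x. x - h \<in> U})"
  have oS: "open S" unfolding S_def using U by (intro open_UN ballI open_translate)
  have H0: "0 \<in> H" by (simp add: H_def)
  have US: "U \<subseteq> S" unfolding S_def using H0 by (auto intro!: bexI[of _ 0])
  have Hadd: "h + k \<in> H" if "h \<in> H" "k \<in> H" for h k
    using that by (simp add: H_def add.assoc)
  have Hneg: "- h \<in> H" if "h \<in> H" for h
  proof -
    have "f (- h + z) = f (h + (- h + z))" for z using that by (simp only: H_def mem_Collect_eq)
    then show ?thesis by (simp add: H_def)
  qed
  have VH: "x - h \<in> V \<longleftrightarrow> x \<in> V" if "h \<in> H" for x h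
  proof -
    have "f (h + (x - h)) = f (x - h)" using that unfolding H_def by blast
    then show ?thesis unfolding V_def by simp
  qed
  have SH: "y \<in> S" if "x \<in> S" "y - x \<in> H" for x y
  proof -
    obtain h where h: "h \<in> H" "x - h \<in> U" using \<open>x \<in> S\<close> unfolding S_def by auto
    have "y - ((y - x) + h) = x - h" by simp
    then have "y \<in> {z. z - ((y - x) + h) \<in> U}" using h(2) by (simp only: mem_Collect_eq)
    then show ?thesis unfolding S_def using Hadd[OF that(2) h(1)] by (rule UN_I[rotated])
  qed
  have "emeasure \<nu> (S - V) = 0"
  proof (rule null_if_compact_null)
    show "S - V \<in> sets borel" using oS oV by auto
    fix K assume K: "compact K" "K \<subseteq> S - V"
    obtain F where F: "F \<subseteq> H" "finite F" "K \<subseteq> (\<Union>h\<in>F. {x. x - h \<in> U})"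
    proof (rule compactE_image[OF K(1), of H "\<lambda>h. {x. x - h \<in> U}"])
      show "K \<subseteq> (\<Union>h\<in>H. {x. x - h \<in> U})" using K(2) unfolding S_def by blast
    qed (rule open_translate[OF U])
    have null: "emeasure \<nu> {x. - h + x \<in> U - V} = 0" for h
      using U oV f(3) by (subst emeasure_translate) (auto simp: V_def)
    have meas: "{x. - h + x \<in> U - V} \<in> sets borel" for h
      using measurable_sets_borel[OF translation_measurable, of "U - V" "- h"] U oV
      by (simp add: vimage_def)
    have "emeasure \<nu> K \<le> emeasure \<nu> (\<Union>h\<in>F. {x. - h + x \<in> U - V})"
    proof (rule emeasure_mono)
      show "K \<subseteq> (\<Union>h\<in>F. {x. - h + x \<in> U - V})"
      proof
        fix x assume "x \<in> K"
        then obtain h where h: "h \<in> F" "x - h \<in> U" using F(3) by auto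
        moreover have "x - h \<notin> V" using VH[of h x] h F(1) K(2) \<open>x \<in> K\<close> by auto
        ultimately show "x \<in> (\<Union>h\<in>F. {x. - h + x \<in> U - V})" by auto
      qed
      show "(\<Union>h\<in>F. {x. - h + x \<in> U - V}) \<in> sets \<nu>"
        using meas F(2) by (intro sets.finite_UN) (simp_all only: sets_haar)
    qed
    also have "\<dots> \<le> (\<Sum>h\<in>F. emeasure \<nu> {x. - h + x \<in> U - V})"
      by (intro emeasure_subadditive_finite F(2) image_subsetI) (simp only: sets_haar meas)
    also have "\<dots> = 0" by (simp only: null sum.neutral_const)
    finally show "emeasure \<nu> K = 0" by simp
  qed
  moreover have "S - U \<subseteq> S - V" using f(2) V_def by auto
  ultimately have nullS: "emeasure \<nu> (S - U) = 0"
    using emeasure_mono[of "S - U" "S - V" \<nu>] oS oV by auto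
  define d where "d x y = (SUP z. \<bar>f (x + z) - f (y + z)\<bar>)" for x y
  have "bounded (range f)" using compact_continuous_image[OF f(1) cpt] by (rule compact_imp_bounded)
  then obtain B where B: "\<And>x. \<bar>f x\<bar> \<le> B" unfolding bounded_iff by auto
  have bdd: "bdd_above (range (\<lambda>z. \<bar>f (x + z) - f (y + z)\<bar>))" for x y
  proof (rule bdd_aboveI2)
    fix z show "\<bar>f (x + z) - f (y + z)\<bar> \<le> 2 * B" using B[of "x + z"] B[of "y + z"] by linarith
  qed
  have d_ge: "\<bar>f (x + z) - f (y + z)\<bar> \<le> d x y" for x y z
    unfolding d_def by (rule cSUP_upper[OF _ bdd]) auto
  have d_le: "d x y \<le> c" if "\<And>z. \<bar>f (x + z) - f (y + z)\<bar> \<le> c" for x y c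
    unfolding d_def using that by (intro cSUP_least) auto
  have d_nonneg: "0 \<le> d x y" for x y using d_ge[of x 0 y] by linarith
  have d_tri: "d x y \<le> d x x' + d x' y" for x x' y
  proof (rule d_le)
    fix z show "\<bar>f (x + z) - f (y + z)\<bar> \<le> d x x' + d x' y"
      using d_ge[of x z x'] d_ge[of x' z y] by linarith
  qed
  have d_sym: "d x y = d y x" for x y unfolding d_def by (simp add: abs_minus_commute)
  have d_zero: "x - y \<in> H" if "d x y = 0" for x y
  proof -
    have "f ((x - y) + z) = f z" for z
      using d_ge[of x "z - y" y] that by (simp add: algebra_simps)
    then show ?thesis by (simp add: H_def)
  qed
  have d_small: "\<exists>W. open W \<and> 0 \<in> W \<and> (\<forall>x y. x - y \<in> W \<longrightarrow> d x y \<le> e)" if "0 < e" for e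
  proof -
    obtain W where W: "open W" "0 \<in> W" "\<And>a b. a - b \<in> W \<Longrightarrow> \<bar>f a - f b\<bar> < e"
      using continuous_real_uniform_nbhd[OF cpt f(1) \<open>0 < e\<close>] by blast
    have "d x y \<le> e" if "x - y \<in> W" for x y
      using W(3)[of "x + _" "y + _"] that by (intro d_le) (auto intro: less_imp_le)
    with W show ?thesis by blast
  qed
  (* d is continuous near the diagonal, so functions that are 1-Lipschitz for d are continuous. *)
  have cont_if: "continuous_on UNIV g" if g: "\<And>x y. g x \<le> g y + d x y" for g :: "'g \<Rightarrow> real"
  proof (unfold continuous_on_eq_continuous_at[OF open_UNIV], intro ballI)
    fix x
    show "isCont g x" unfolding continuous_at tendsto_iff
    proof (intro allI impI)
      fix e :: real assume "0 < e"
      then obtain W where W: "open W" "0 \<in> W" "\<And>x y. x - y \<in> W \<Longrightarrow> d x y \<le> e / 2"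
        using d_small[of "e / 2"] by auto
      have "\<forall>\<^sub>F y in nhds x. y \<in> {y. y - x \<in> W}"
        using open_translate[OF W(1), of x] W(2) by (intro eventually_nhds_in_open) auto
      then have "\<forall>\<^sub>F y in at x. y - x \<in> W" by (simp add: eventually_at_filter eventually_mono)
      then show "\<forall>\<^sub>F y in at x. dist (g y) (g x) < e"
      proof eventually_elim
        case (elim y)
        then have "d y x \<le> e / 2" using W(3) by blast
        then show ?case using g[of x y] g[of y x] d_sym[of x y] \<open>0 < e\<close>
          by (auto simp: dist_real_def abs_if)
      qed
    qed
  qed
  have d_cont: "continuous_on UNIV (d x)" for x
  proof (rule cont_if)
    fix y y' show "d x y \<le> d x y' + d y y'" using d_tri[of x y y'] d_sym[of y y'] by simp
  qed
  show ?thesis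
  proof (cases "S = UNIV")
    case True
    then show ?thesis using nullS by (intro exI[of _ "\<lambda>_. 1"]) auto
  next
    case False
    define \<phi> where "\<phi> x = (INF y\<in>- S. d x y)" for x
    have bd: "bdd_below (d x ` (- S))" for x using d_nonneg by (intro bdd_belowI2[of _ 0]) auto
    have "continuous_on UNIV \<phi>"
    proof (rule cont_if)
      fix x x'
      have "\<phi> x - d x x' \<le> d x' y" if "y \<in> - S" for y
        using cINF_lower[OF bd that, of x] d_tri[of x y x'] unfolding \<phi>_def by linarith
      then have "\<phi> x - d x x' \<le> \<phi> x'"
        unfolding \<phi>_def[of x'] using False by (intro cINF_greatest) auto
      then show "\<phi> x \<le> \<phi> x' + d x x'" by simp
    qed
    moreover have "\<phi> x > 0 \<longleftrightarrow> x \<in> S" for x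
    proof
      assume "\<phi> x > 0"
      moreover have "d x x = 0" unfolding d_def by simp
      ultimately show "x \<in> S" using cINF_lower[OF bd, of x x] unfolding \<phi>_def by force
    next
      assume x: "x \<in> S"
      have "compact (- S)" using oS by (intro closed_compact) auto
      then obtain y where y: "y \<in> - S" "\<And>y'. y' \<in> - S \<Longrightarrow> d x y \<le> d x y'"
        using continuous_attains_inf[of "- S" "d x"] False continuous_on_subset[OF d_cont[of x], of "- S"]
        by auto
      have "d x y \<noteq> 0" using d_zero[of x y] SH[OF x, of y] Hneg[of "x - y"] y(1) by auto
      moreover have "d x y \<le> \<phi> x" unfolding \<phi>_def using y by (intro cINF_greatest) auto
      ultimately show "\<phi> x > 0" using d_nonneg[of x y] by linarith
    qed
    ultimately show ?thesis using US nullS by (intro exI[of _ \<phi>]) auto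
  qed
qed

end

section \<open>Families of maps preserving Haar measure\<close>

text \<open>The conditions are those satisfied both by a strongly measurable family of automorphisms and by
  the family of all translations, the latter being needed for the uniqueness of Haar measure.
  Measurability is asked for the subbasic sets of the compact-open topology only, so that no topology
  on a space of maps has to be fixed.\<close>
locale haar_flow = compact_haar \<nu> + m: finite_measure m
  for \<nu> :: "'g::{topological_ab_group_add,t2_space} measure" and m :: "'w measure" +
  fixes T :: "'w \<Rightarrow> 'g \<Rightarrow> 'g"
  assumes compact_open_sets:
      "compact K \<Longrightarrow> open U \<Longrightarrow> {u \<in> space m. T u ` K \<subseteq> U} \<in> sets m"
    and essentially_separable: "open W \<Longrightarrow> 0 \<in> W \<Longrightarrow>
      \<exists>D. countable D \<and> (\<forall>B\<in>D. continuous_on UNIV B) \<and> (AE u in m. \<exists>B\<in>D. \<forall>x. T u x - B x \<in> W)"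
    and continuous_map: "u \<in> space m \<Longrightarrow> continuous_on UNIV (T u)"
    and preserves: "u \<in> space m \<Longrightarrow> distr \<nu> borel (T u) = \<nu>"
begin

sublocale mn: pair_sigma_finite m \<nu>
  by unfold_locales

lemma snd_borel [measurable]: "snd \<in> m \<Otimes>\<^sub>M \<nu> \<rightarrow>\<^sub>M borel"
  using measurable_snd[of m \<nu>] by (simp cong: measurable_cong_sets)

lemma map_measurable [measurable]: "u \<in> space m \<Longrightarrow> T u \<in> borel \<rightarrow>\<^sub>M borel"
  by (intro borel_measurable_continuous_onI continuous_map)

lemma nn_integral_map:
  assumes "f \<in> borel_measurable borel" "u \<in> space m"
  shows "(\<integral>\<^sup>+x. f (T u x) \<partial>\<nu>) = integral\<^sup>N \<nu> f"
proof -
  have "integral\<^sup>N (distr \<nu> borel (T u)) f = (\<integral>\<^sup>+x. f (T u x) \<partial>\<nu>)"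
    using assms by (intro nn_integral_distr) auto
  then show ?thesis by (simp add: preserves assms)
qed

text \<open>The set of all \<open>u\<close> with \<open>f \<circ> T u\<close> uniformly close to \<open>f \<circ> B\<close> is given by uncountably many
  conditions and need not be measurable. It is replaced by a measurable set \<open>E\<close> between two such
  sets: cut the range of \<open>f \<circ> B\<close> into steps of height \<open>e\<close>, and require \<open>T u\<close> to send each of the
  compact level sets \<open>K n j\<close> into the open set \<open>U j\<close>, where \<open>f\<close> lies within one step of the level
  \<open>j\<close>.\<close>
lemma approximating_pieces:
  fixes f :: "'g \<Rightarrow> real"
  assumes f: "continuous_on UNIV f" and "0 < e"
  shows "\<exists>B E. (\<forall>n::nat. continuous_on UNIV (B n) \<and> E n \<in> sets m \<and>
           (\<forall>u\<in>E n. \<forall>x. \<bar>f (T u x) - f (B n x)\<bar> \<le> 2 * e)) \<and> (AE u in m. \<exists>n. u \<in> E n)"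
proof -
  obtain W where W: "open W" "0 \<in> W" "\<And>a b. a - b \<in> W \<Longrightarrow> \<bar>f a - f b\<bar> < e"
    using continuous_real_uniform_nbhd[OF cpt f \<open>0 < e\<close>] by blast
  obtain D where D: "countable D" "\<forall>B\<in>D. continuous_on UNIV B"
      "AE u in m. \<exists>B\<in>D. \<forall>x. T u x - B x \<in> W"
    using essentially_separable[OF W(1,2)] by blast
  (* Inserting the identity makes the set nonempty, as the enumeration requires. *)
  define B where "B = from_nat_into (insert id D)"
  have B_cont: "continuous_on UNIV (B n)" for n
    using from_nat_into[of "insert id D" n] D(2) unfolding B_def by (auto simp: id_def)
  define K where "K n j = {x. of_int j * e \<le> f (B n x) \<and> f (B n x) \<le> (of_int j + 1) * e}" for n and j :: int
  define U where "U j = {y. (of_int j - 1) * e < f y \<and> f y < (of_int j + 2) * e}" for j :: int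
  define E where "E n = {u \<in> space m. \<forall>j. T u ` K n j \<subseteq> U j}" for n
  have fB: "continuous_on UNIV (\<lambda>x. f (B n x))" for n
    using continuous_on_compose2[OF f B_cont] by simp
  have "compact (K n j)" for n j
    unfolding K_def by (intro closed_compact closed_Collect_conj closed_Collect_le fB continuous_on_const)
  moreover have "open (U j)" for j
    unfolding U_def by (intro open_Collect_conj open_Collect_less f continuous_on_const)
  ultimately have "E n \<in> sets m" for n
    unfolding E_def by (intro sets.sets_Collect_countable_All compact_open_sets) auto
  moreover have "\<bar>f (T u x) - f (B n x)\<bar> \<le> 2 * e" if "u \<in> E n" for u n x
  proof -
    define j where "j = \<lfloor>f (B n x) / e\<rfloor>"
    have "of_int j \<le> f (B n x) / e" "f (B n x) / e < of_int j + 1" unfolding j_def by linarith+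
    then have j: "of_int j * e \<le> f (B n x)" "f (B n x) < (of_int j + 1) * e"
      using \<open>0 < e\<close> by (simp_all add: field_simps)
    then have "T u x \<in> U j" using that unfolding E_def K_def by fastforce
    then show ?thesis using j unfolding U_def by (auto simp: algebra_simps)
  qed
  moreover have "AE u in m. \<exists>n. u \<in> E n"
    using D(3) AE_space
  proof eventually_elim
    case (elim u)
    then obtain C where C: "C \<in> D" "\<And>x. T u x - C x \<in> W" by blast
    then obtain n where n: "B n = C"
      unfolding B_def using from_nat_into_surj[of "insert id D" C] D(1) by auto
    have "T u x \<in> U j" if "x \<in> K n j" for x j
    proof -
      have "\<bar>f (T u x) - f (B n x)\<bar> < e" using W(3) C n by simp
      then show ?thesis using that unfolding K_def U_def by (auto simp: algebra_simps)
    qed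
    then show ?case using elim unfolding E_def by auto
  qed
  ultimately show ?thesis using B_cont by (intro exI[of _ B] exI[of _ E]) auto
qed

text \<open>At each precision, choosing the first approximating piece that contains \<open>u\<close> gives a function
  \<open>f (B (N u) x)\<close> which is product measurable since \<open>N\<close> takes countably many values; these functions
  converge uniformly in \<open>x\<close>, for almost every \<open>u\<close>. The exceptional set does not depend on \<open>x\<close>.\<close>
lemma continuous_compose_ae_product_measurable:
  fixes f :: "'g \<Rightarrow> real"
  assumes f: "continuous_on UNIV f"
  shows "\<exists>k\<in>borel_measurable (m \<Otimes>\<^sub>M \<nu>). AE u in m. \<forall>x. k (u, x) = f (T u x)"
proof -
  have "\<forall>i. \<exists>B E. (\<forall>n::nat. continuous_on UNIV (B n) \<and> E n \<in> sets m \<and>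
           (\<forall>u\<in>E n. \<forall>x. \<bar>f (T u x) - f (B n x)\<bar> \<le> 2 * inverse (Suc i))) \<and>
           (AE u in m. \<exists>n. u \<in> E n)"
    by (intro allI approximating_pieces f) simp
  then obtain B E where BE: "\<And>i n::nat. continuous_on UNIV (B i n)" "\<And>i n. E i n \<in> sets m"
      "\<And>i n u x. u \<in> E i n \<Longrightarrow> \<bar>f (T u x) - f (B i n x)\<bar> \<le> 2 * inverse (Suc i)"
      "\<And>i. AE u in m. \<exists>n. u \<in> E i n"
    unfolding choice_iff by blast
  define N where "N i u = (LEAST n. u \<in> E i n)" for i u
  have N_meas [measurable]: "N i \<in> m \<rightarrow>\<^sub>M count_space UNIV" for i
    unfolding N_def by (intro measurable_Least pred_sets2[OF BE(2)]) simp
  define k where "k i z = f (B i (N i (fst z)) (snd z))" for i z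
  have fB: "(\<lambda>x. f (B i n x)) \<in> borel_measurable borel" for i n
    by (intro borel_measurable_continuous_onI continuous_on_compose2[OF f BE(1)]) auto
  have k_meas [measurable]: "k i \<in> borel_measurable (m \<Otimes>\<^sub>M \<nu>)" for i
    unfolding k_def
  proof (rule measurable_compose_countable)
    show "(\<lambda>z. f (B i n (snd z))) \<in> borel_measurable (m \<Otimes>\<^sub>M \<nu>)" for n
      by (rule measurable_compose[OF snd_borel fB])
    show "(\<lambda>z. N i (fst z)) \<in> m \<Otimes>\<^sub>M \<nu> \<rightarrow>\<^sub>M count_space UNIV" by measurable
  qed
  have "AE u in m. \<forall>i. \<exists>n. u \<in> E i n" using BE(4) by (simp add: AE_all_countable)
  then have "AE u in m. \<forall>x. lim (\<lambda>i. k i (u, x)) = f (T u x)"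
  proof eventually_elim
    case (elim u)
    show ?case
    proof
      fix x
      have "norm (k i (u, x) - f (T u x)) \<le> 2 * inverse (Suc i)" for i
      proof -
        have "u \<in> E i (N i u)" unfolding N_def using elim by (auto intro: LeastI_ex)
        from BE(3)[OF this, of x] show ?thesis by (simp add: k_def abs_minus_commute)
      qed
      then have "\<forall>\<^sub>F i in sequentially. norm (k i (u, x) - f (T u x)) \<le> 2 * inverse (real (Suc i))"
        by (intro always_eventually allI)
      moreover have "(\<lambda>i. 2 * inverse (real (Suc i))) \<longlonglongrightarrow> 0"
        using tendsto_mult_right[OF LIMSEQ_inverse_real_of_nat, of 2] by simp
      ultimately have "(\<lambda>i. k i (u, x) - f (T u x)) \<longlonglongrightarrow> 0"
        by (rule Lim_null_comparison)
      then show "lim (\<lambda>i. k i (u, x)) = f (T u x)"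
        by (intro limI) (simp add: LIM_zero_iff)
    qed
  qed
  moreover have "(\<lambda>z. lim (\<lambda>i. k i z)) \<in> borel_measurable (m \<Otimes>\<^sub>M \<nu>)"
    by (intro borel_measurable_lim_metric k_meas)
  ultimately show ?thesis by (intro bexI[where x="\<lambda>z. lim (\<lambda>i. k i z)"])
qed

lemma cozero_vimage:
  fixes f :: "'g \<Rightarrow> real"
  assumes f: "continuous_on UNIV f"
  shows "\<exists>P\<in>sets (m \<Otimes>\<^sub>M \<nu>). emeasure (m \<Otimes>\<^sub>M \<nu>) P = emeasure m (space m) * emeasure \<nu> {x. f x > 0}
     \<and> (AE u in m. \<forall>x. (u, x) \<in> P \<longleftrightarrow> f (T u x) > 0)"
proof -
  obtain k where k [measurable]: "k \<in> borel_measurable (m \<Otimes>\<^sub>M \<nu>)" and kf: "AE u in m. \<forall>x. k (u, x) = f (T u x)"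
    using continuous_compose_ae_product_measurable[OF f] by blast
  define P where "P = {z \<in> space (m \<Otimes>\<^sub>M \<nu>). k z > 0}"
  have P [measurable]: "P \<in> sets (m \<Otimes>\<^sub>M \<nu>)" unfolding P_def by measurable
  have pos: "{x. f x > 0} \<in> sets borel"
    by (intro borel_open open_Collect_less f continuous_on_const)
  have PT: "AE u in m. \<forall>x. (u, x) \<in> P \<longleftrightarrow> f (T u x) > 0"
    using kf AE_space by eventually_elim (auto simp: P_def space_pair_measure)
  have "emeasure (m \<Otimes>\<^sub>M \<nu>) P = (\<integral>\<^sup>+u. \<integral>\<^sup>+x. indicator P (u, x) \<partial>\<nu> \<partial>m)"
    by (rule emeasure_pair_measure[OF P])
  also have "\<dots> = (\<integral>\<^sup>+u. emeasure \<nu> {x. f x > 0} \<partial>m)"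
    using PT AE_space[of m]
  proof (intro nn_integral_cong_AE, eventually_elim)
    case (elim u)
    have "(\<integral>\<^sup>+x. indicator P (u, x) \<partial>\<nu>) = (\<integral>\<^sup>+x. indicator {x. f x > 0} (T u x) \<partial>\<nu>)"
      using elim by (intro nn_integral_cong) (auto simp: indicator_def)
    also have "\<dots> = (\<integral>\<^sup>+x. indicator {x. f x > 0} x \<partial>\<nu>)"
      using elim pos by (intro nn_integral_map) auto
    finally show ?case using pos by simp
  qed
  also have "\<dots> = emeasure m (space m) * emeasure \<nu> {x. f x > 0}"
    by (simp add: mult.commute)
  finally have "emeasure (m \<Otimes>\<^sub>M \<nu>) P = emeasure m (space m) * emeasure \<nu> {x. f x > 0}" .
  with P PT show ?thesis by blast
qed

end

context haar_flow
begin

lemma AE_fst: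
  assumes "AE u in m. Q u"
  shows "AE z in m \<Otimes>\<^sub>M \<nu>. Q (fst z)"
proof -
  obtain Z where Z: "{u \<in> space m. \<not> Q u} \<subseteq> Z" "emeasure m Z = 0" "Z \<in> sets m"
    using assms by (rule AE_E)
  have "emeasure (m \<Otimes>\<^sub>M \<nu>) (Z \<times> space \<nu>) = 0"
    using Z by (subst emeasure_pair_measure_Times) auto
  moreover have "Z \<times> space \<nu> \<in> sets (m \<Otimes>\<^sub>M \<nu>)"
    using Z by (intro pair_measureI sets.top)
  ultimately show ?thesis
    using Z(1) by (intro AE_I[where N="Z \<times> space \<nu>"]) (auto simp: space_pair_measure)
qed

text \<open>The set where \<open>Q\<close> holds need not be measurable, so Fubini's theorem is applied to a measurable
  null set containing its complement.\<close>
lemma AE_swap: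
  assumes "AE z in m \<Otimes>\<^sub>M \<nu>. Q z"
  shows "AE x in \<nu>. AE u in m. Q (u, x)"
proof -
  obtain Z where Z: "{z \<in> space (m \<Otimes>\<^sub>M \<nu>). \<not> Q z} \<subseteq> Z" "emeasure (m \<Otimes>\<^sub>M \<nu>) Z = 0" "Z \<in> sets (m \<Otimes>\<^sub>M \<nu>)"
    using assms by (rule AE_E)
  have "AE z in m \<Otimes>\<^sub>M \<nu>. z \<notin> Z" using Z by (intro AE_not_in) auto
  then have "AE u in m. AE x in \<nu>. (u, x) \<notin> Z" by (rule mn.AE_pair)
  moreover have "{z \<in> space (m \<Otimes>\<^sub>M \<nu>). (fst z, snd z) \<notin> Z} \<in> sets (m \<Otimes>\<^sub>M \<nu>)"
    using sets.compl_sets[OF Z(3)] by (simp only: prod.collapse set_diff_eq)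
  ultimately have "AE x in \<nu>. AE u in m. (u, x) \<notin> Z" by (subst (asm) mn.AE_commute) auto
  then show ?thesis
  proof eventually_elim
    case (elim x)
    from elim AE_space show ?case
    proof eventually_elim
      case (elim u)
      then show ?case using Z(1) by (auto simp: space_pair_measure)
    qed
  qed
qed

text \<open>A null set lies in open sets of arbitrarily small measure, hence in cozero sets of
  arbitrarily small measure. Their preimages are product measurable up to a null set of \<open>u\<close>, and
  as each map preserves Haar measure, their measures tend to \<open>0\<close> as well.\<close>
lemma null_set_vimage:
  assumes N: "N \<in> sets borel" "emeasure \<nu> N = 0"
  shows "AE z in m \<Otimes>\<^sub>M \<nu>. T (fst z) (snd z) \<notin> N"
proof -
  have "\<exists>P\<in>sets (m \<Otimes>\<^sub>M \<nu>). emeasure (m \<Otimes>\<^sub>M \<nu>) P \<le> emeasure m (space m) * ennreal (inverse (Suc n))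
     \<and> (AE u in m. \<forall>x. T u x \<in> N \<longrightarrow> (u, x) \<in> P)" for n
  proof -
    obtain U where U: "open U" "N \<subseteq> U" "emeasure \<nu> (U - N) < ennreal (inverse (Suc n))"
      by (rule outer_regular[OF N(1), of "inverse (real (Suc n))"]) (simp, blast)
    obtain \<phi> :: "'g \<Rightarrow> real" where \<phi>: "continuous_on UNIV \<phi>" "U \<subseteq> {x. \<phi> x > 0}"
        "emeasure \<nu> ({x. \<phi> x > 0} - U) = 0"
      using open_cozero_hull[OF U(1)] by blast
    have meas: "{x. \<phi> x > 0} \<in> sets borel" "U \<in> sets borel"
      by (intro borel_open open_Collect_less \<phi> continuous_on_const) (intro borel_open U)
    have "emeasure \<nu> {x. \<phi> x > 0} = emeasure \<nu> (({x. \<phi> x > 0} - U) \<union> ((U - N) \<union> N))"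
      using U \<phi> by (intro arg_cong[where f="emeasure \<nu>"]) auto
    also have "\<dots> \<le> emeasure \<nu> ({x. \<phi> x > 0} - U) + emeasure \<nu> ((U - N) \<union> N)"
      using meas N by (intro emeasure_subadditive) auto
    also have "\<dots> = emeasure \<nu> ((U - N) \<union> N)" by (simp only: \<phi>(3) add_0)
    also have "\<dots> \<le> emeasure \<nu> (U - N) + emeasure \<nu> N"
      using meas N by (intro emeasure_subadditive) auto
    also have "\<dots> = emeasure \<nu> (U - N)" by (simp only: N(2) add_0_right)
    also note U(3)
    finally have le: "emeasure \<nu> {x. \<phi> x > 0} \<le> ennreal (inverse (Suc n))" by (rule less_imp_le)
    obtain P where P: "P \<in> sets (m \<Otimes>\<^sub>M \<nu>)"
        "emeasure (m \<Otimes>\<^sub>M \<nu>) P = emeasure m (space m) * emeasure \<nu> {x. \<phi> x > 0}"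
        "AE u in m. \<forall>x. (u, x) \<in> P \<longleftrightarrow> \<phi> (T u x) > 0"
      using cozero_vimage[OF \<phi>(1)] by blast
    have "AE u in m. \<forall>x. T u x \<in> N \<longrightarrow> (u, x) \<in> P"
      using P(3) by eventually_elim (use U \<phi> in blast)
    moreover have "emeasure (m \<Otimes>\<^sub>M \<nu>) P \<le> emeasure m (space m) * ennreal (inverse (Suc n))"
      unfolding P(2) by (intro mult_left_mono le) simp
    ultimately show ?thesis using P(1) by blast
  qed
  then have "\<exists>P. \<forall>n::nat. P n \<in> sets (m \<Otimes>\<^sub>M \<nu>) \<and>
      emeasure (m \<Otimes>\<^sub>M \<nu>) (P n) \<le> emeasure m (space m) * ennreal (inverse (Suc n)) \<and>
      (AE u in m. \<forall>x. T u x \<in> N \<longrightarrow> (u, x) \<in> P n)"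
    unfolding Bex_def by (intro choice allI)
  then obtain P where P: "\<forall>n::nat. P n \<in> sets (m \<Otimes>\<^sub>M \<nu>) \<and>
      emeasure (m \<Otimes>\<^sub>M \<nu>) (P n) \<le> emeasure m (space m) * ennreal (inverse (Suc n)) \<and>
      (AE u in m. \<forall>x. T u x \<in> N \<longrightarrow> (u, x) \<in> P n)" ..
  then have P: "\<And>n::nat. P n \<in> sets (m \<Otimes>\<^sub>M \<nu>)"
      "\<And>n. emeasure (m \<Otimes>\<^sub>M \<nu>) (P n) \<le> emeasure m (space m) * ennreal (inverse (Suc n))"
      "\<And>n. AE u in m. \<forall>x. T u x \<in> N \<longrightarrow> (u, x) \<in> P n"
    by (simp_all only:)
  define Q where "Q = (\<Inter>n. P n)"
  have Q: "Q \<in> sets (m \<Otimes>\<^sub>M \<nu>)" unfolding Q_def using P(1) by (intro sets.countable_INT) auto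
  have "emeasure (m \<Otimes>\<^sub>M \<nu>) Q \<le> ennreal (measure m (space m) * inverse (Suc n))" for n
  proof -
    have "emeasure (m \<Otimes>\<^sub>M \<nu>) Q \<le> emeasure (m \<Otimes>\<^sub>M \<nu>) (P n)"
      unfolding Q_def by (intro emeasure_mono P(1)) auto
    also note P(2)[of n]
    finally show ?thesis by (simp only: m.emeasure_eq_measure ennreal_mult' measure_nonneg)
  qed
  moreover have "(\<lambda>n. ennreal (measure m (space m) * inverse (Suc n))) \<longlonglongrightarrow> ennreal (measure m (space m) * 0)"
    by (intro tendsto_ennrealI tendsto_mult_left LIMSEQ_inverse_real_of_nat)
  ultimately have "emeasure (m \<Otimes>\<^sub>M \<nu>) Q \<le> ennreal (measure m (space m) * 0)"
    by (intro LIMSEQ_le_const) blast+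
  then have "Q \<in> null_sets (m \<Otimes>\<^sub>M \<nu>)" using Q by auto
  then have "AE z in m \<Otimes>\<^sub>M \<nu>. z \<notin> Q" by (rule AE_not_in)
  moreover have "AE u in m. \<forall>n. \<forall>x. T u x \<in> N \<longrightarrow> (u, x) \<in> P n" using P(3) by (simp add: AE_all_countable)
  then have "AE z in m \<Otimes>\<^sub>M \<nu>. \<forall>n x. T (fst z) x \<in> N \<longrightarrow> (fst z, x) \<in> P n" by (rule AE_fst)
  ultimately show ?thesis
  proof eventually_elim
    case (elim z)
    show ?case
    proof
      assume "T (fst z) (snd z) \<in> N"
      then have "(fst z, snd z) \<in> Q" using elim(2) unfolding Q_def by blast
      then show False using elim(1) by simp
    qed
  qed
qed

text \<open>An open set differs by a null set from a cozero set, whose preimage is known to be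
  measurable up to a null set.\<close>
lemma map_completion_measurable:
  "(\<lambda>z. T (fst z) (snd z)) \<in> completion (m \<Otimes>\<^sub>M \<nu>) \<rightarrow>\<^sub>M borel"
proof (rule borel_measurableI)
  fix U :: "'g set" assume U: "open U"
  obtain \<phi> :: "'g \<Rightarrow> real" where \<phi>: "continuous_on UNIV \<phi>" "U \<subseteq> {x. \<phi> x > 0}"
      "emeasure \<nu> ({x. \<phi> x > 0} - U) = 0"
    using open_cozero_hull[OF U(1)] by blast
  have meas: "{x. \<phi> x > 0} - U \<in> sets borel"
    by (intro sets.Diff borel_open open_Collect_less \<phi> continuous_on_const U)
  obtain P where P: "P \<in> sets (m \<Otimes>\<^sub>M \<nu>)" "AE u in m. \<forall>x. (u, x) \<in> P \<longleftrightarrow> \<phi> (T u x) > 0"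
    using cozero_vimage[OF \<phi>(1)] by blast
  from AE_fst[OF P(2)] null_set_vimage[OF meas \<phi>(3)]
  have "AE z in m \<Otimes>\<^sub>M \<nu>. z \<in> P \<longleftrightarrow> T (fst z) (snd z) \<in> U"
  proof eventually_elim
    case (elim z)
    then have "(fst z, snd z) \<in> P \<longleftrightarrow> \<phi> (T (fst z) (snd z)) > 0" by blast
    with elim(2) \<phi>(2) show ?case by auto
  qed
  then obtain Z where Z: "{z \<in> space (m \<Otimes>\<^sub>M \<nu>). \<not> (z \<in> P \<longleftrightarrow> T (fst z) (snd z) \<in> U)} \<subseteq> Z"
      "emeasure (m \<Otimes>\<^sub>M \<nu>) Z = 0" "Z \<in> sets (m \<Otimes>\<^sub>M \<nu>)"
    by (rule AE_E)
  let ?S = "(\<lambda>z. T (fst z) (snd z)) -` U \<inter> space (m \<Otimes>\<^sub>M \<nu>)"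
  have "?S = (P - Z) \<union> (?S \<inter> Z)" using Z(1) sets.sets_into_space[OF P(1)] by blast
  moreover have "(P - Z) \<union> (?S \<inter> Z) \<in> sets (completion (m \<Otimes>\<^sub>M \<nu>))"
    using P(1) Z(2,3) by (intro sets_completionI[of _ "P - Z" "?S \<inter> Z" Z] null_setsI) auto
  ultimately show "(\<lambda>z. T (fst z) (snd z)) -` U \<inter> space (completion (m \<Otimes>\<^sub>M \<nu>)) \<in> sets (completion (m \<Otimes>\<^sub>M \<nu>))"
    by (simp only: space_completion)
qed

lemma compose_ae_product_measurable:
  fixes f :: "'g \<Rightarrow> complex"
  assumes [measurable]: "f \<in> borel_measurable borel"
  shows "\<exists>k\<in>borel_measurable (m \<Otimes>\<^sub>M \<nu>). AE z in m \<Otimes>\<^sub>M \<nu>. k z = f (T (fst z) (snd z))"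
proof -
  note [measurable] = map_completion_measurable
  have "(\<lambda>z. Re (f (T (fst z) (snd z)))) \<in> borel_measurable (completion (m \<Otimes>\<^sub>M \<nu>))" by measurable
  from completion_ex_borel_measurable_real[OF this] obtain a where
    a: "a \<in> borel_measurable (m \<Otimes>\<^sub>M \<nu>)" "AE z in m \<Otimes>\<^sub>M \<nu>. Re (f (T (fst z) (snd z))) = a z" by blast
  have "(\<lambda>z. Im (f (T (fst z) (snd z)))) \<in> borel_measurable (completion (m \<Otimes>\<^sub>M \<nu>))" by measurable
  from completion_ex_borel_measurable_real[OF this] obtain b where
    b: "b \<in> borel_measurable (m \<Otimes>\<^sub>M \<nu>)" "AE z in m \<Otimes>\<^sub>M \<nu>. Im (f (T (fst z) (snd z))) = b z" by blast
  have "(\<lambda>z. of_real (a z) + \<i> * of_real (b z)) \<in> borel_measurable (m \<Otimes>\<^sub>M \<nu>)"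
    using a(1) b(1) by measurable
  moreover have "AE z in m \<Otimes>\<^sub>M \<nu>. of_real (a z) + \<i> * of_real (b z) = f (T (fst z) (snd z))"
    using a(2) b(2) by eventually_elim (auto simp: complex_eq_iff)
  ultimately show ?thesis by (intro bexI[where x="\<lambda>z. of_real (a z) + \<i> * of_real (b z)"])
qed

text \<open>Integrating first in \<open>x\<close> gives the same value for almost every \<open>u\<close>, by invariance of Haar
  measure. The function \<open>w\<close> is going to be the norm or a power of it.\<close>
lemma Tonelli_compose:
  assumes k: "k \<in> borel_measurable (m \<Otimes>\<^sub>M \<nu>)" "AE z in m \<Otimes>\<^sub>M \<nu>. k z = f (T (fst z) (snd z))"
    and w: "w \<in> borel_measurable borel" and f: "f \<in> borel_measurable borel"
  shows "(\<integral>\<^sup>+x. \<integral>\<^sup>+u. w (k (u, x)) \<partial>m \<partial>\<nu>) = emeasure m (space m) * (\<integral>\<^sup>+x. w (f x) \<partial>\<nu>)"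
    and "(\<integral>\<^sup>+z. w (k z) \<partial>(m \<Otimes>\<^sub>M \<nu>)) = emeasure m (space m) * (\<integral>\<^sup>+x. w (f x) \<partial>\<nu>)"
proof -
  have wk: "(\<lambda>z. w (k z)) \<in> borel_measurable (m \<Otimes>\<^sub>M \<nu>)"
    by (rule measurable_compose[OF k(1) w])
  have wf: "(\<lambda>x. w (f x)) \<in> borel_measurable borel"
    by (rule measurable_compose[OF f w])
  have "AE u in m. (\<integral>\<^sup>+x. w (k (u, x)) \<partial>\<nu>) = (\<integral>\<^sup>+x. w (f x) \<partial>\<nu>)"
    using mn.AE_pair[OF k(2)] AE_space
  proof eventually_elim
    case (elim u)
    have "(\<integral>\<^sup>+x. w (k (u, x)) \<partial>\<nu>) = (\<integral>\<^sup>+x. w (f (T u x)) \<partial>\<nu>)"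
      using elim(1) by (intro nn_integral_cong_AE) auto
    also have "\<dots> = (\<integral>\<^sup>+x. w (f x) \<partial>\<nu>)" using nn_integral_map[OF wf elim(2)] .
    finally show ?case .
  qed
  then have "(\<integral>\<^sup>+u. \<integral>\<^sup>+x. w (k (u, x)) \<partial>\<nu> \<partial>m) = (\<integral>\<^sup>+u. (\<integral>\<^sup>+x. w (f x) \<partial>\<nu>) \<partial>m)"
    by (rule nn_integral_cong_AE)
  also have "\<dots> = emeasure m (space m) * (\<integral>\<^sup>+x. w (f x) \<partial>\<nu>)" by (simp add: mult.commute)
  finally have *: "(\<integral>\<^sup>+u. \<integral>\<^sup>+x. w (k (u, x)) \<partial>\<nu> \<partial>m) = emeasure m (space m) * (\<integral>\<^sup>+x. w (f x) \<partial>\<nu>)" .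
  then show "(\<integral>\<^sup>+z. w (k z) \<partial>(m \<Otimes>\<^sub>M \<nu>)) = emeasure m (space m) * (\<integral>\<^sup>+x. w (f x) \<partial>\<nu>)"
    by (simp only: nn_integral_fst[OF wk])
  then show "(\<integral>\<^sup>+x. \<integral>\<^sup>+u. w (k (u, x)) \<partial>m \<partial>\<nu>) = emeasure m (space m) * (\<integral>\<^sup>+x. w (f x) \<partial>\<nu>)"
    by (simp only: mn.nn_integral_snd[OF wk])
qed

end

section \<open>Uniqueness of Haar measure\<close>

context compact_haar
begin

text \<open>By compactness, finitely many translations approximate all of them up to any neighbourhood of
  \<open>0\<close>; in the conditions of the locale, they take the place of the countable nets.\<close>
lemma translations_flow:
  assumes "compact_haar (\<nu>' :: 'g measure)"
  shows "haar_flow \<nu> \<nu>' (+)"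
proof -
  interpret h: compact_haar \<nu>' by fact
  show ?thesis
  proof unfold_locales
    fix K U :: "'g set" assume K: "compact K" and U: "open U"
    have "{u. (+) u ` K \<subseteq> U} = - (\<lambda>z. snd z - fst z) ` (K \<times> (- U))"
      by (force simp: image_iff algebra_simps)
    moreover have "compact ((\<lambda>z. snd z - fst z) ` (K \<times> (- U)))"
      using K U closed_compact[of "- U"]
      by (intro compact_continuous_image compact_Times continuous_intros) auto
    ultimately have "open {u. (+) u ` K \<subseteq> U}"
      by (simp only: open_Compl compact_imp_closed)
    then show "{u \<in> space \<nu>'. (+) u ` K \<subseteq> U} \<in> sets \<nu>'" by simp
  next
    fix W :: "'g set" assume W: "open W" "0 \<in> W"
    obtain F where F: "finite F" "\<And>x. \<exists>d\<in>F. x - d \<in> W" using finite_translates_cover[OF cpt W] by blast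
    have "\<exists>B\<in>(+) ` F. \<forall>x. u + x - B x \<in> W" for u
      using F(2)[of u] by auto
    then show "\<exists>D. countable D \<and> (\<forall>B\<in>D. continuous_on UNIV B) \<and> (AE u in \<nu>'. \<exists>B\<in>D. \<forall>x. u + x - B x \<in> W)"
      using F(1) by (intro exI[of _ "(+) ` F"]) (auto intro!: continuous_intros countable_finite)
  next
    fix u :: 'g
    show "continuous_on UNIV ((+) u)" by (intro continuous_intros)
    show "distr \<nu> borel ((+) u) = \<nu>" by (rule translation)
  qed
qed

text \<open>Both integrals are equal to the double integral of \<open>f (u + x)\<close>, by integrating in one or in the
  other order.\<close>
lemma continuous_integral_unique:
  fixes f :: "'g \<Rightarrow> real"
  assumes \<nu>': "compact_haar \<nu>'" and f: "continuous_on UNIV f"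
  shows "(\<integral>\<^sup>+x. ennreal (f x) \<partial>\<nu>') = (\<integral>\<^sup>+x. ennreal (f x) \<partial>\<nu>)"
proof -
  interpret h: compact_haar \<nu>' by fact
  interpret t: haar_flow \<nu> \<nu>' "(+)" using \<nu>' by (rule translations_flow)
  obtain k where k: "k \<in> borel_measurable (\<nu>' \<Otimes>\<^sub>M \<nu>)" "AE u in \<nu>'. \<forall>x. k (u, x) = f (u + x)"
    using t.continuous_compose_ae_product_measurable[OF f] by blast
  have ek: "(\<lambda>z. ennreal (k z)) \<in> borel_measurable (\<nu>' \<Otimes>\<^sub>M \<nu>)" using k(1) by measurable
  have f_meas: "(\<lambda>x. ennreal (f x)) \<in> borel_measurable borel"
    using borel_measurable_continuous_onI[OF f] by measurable
  have "(\<integral>\<^sup>+u. \<integral>\<^sup>+x. ennreal (k (u, x)) \<partial>\<nu> \<partial>\<nu>') = (\<integral>\<^sup>+u. (\<integral>\<^sup>+x. ennreal (f x) \<partial>\<nu>) \<partial>\<nu>')"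
    using k(2)
  proof (intro nn_integral_cong_AE, eventually_elim)
    case (elim u)
    then show ?case using t.nn_integral_map[OF f_meas, of u] by simp
  qed
  also have "\<dots> = (\<integral>\<^sup>+x. ennreal (f x) \<partial>\<nu>)" using h.emeasure_space_1 by simp
  finally have 1: "(\<integral>\<^sup>+z. ennreal (k z) \<partial>(\<nu>' \<Otimes>\<^sub>M \<nu>)) = (\<integral>\<^sup>+x. ennreal (f x) \<partial>\<nu>)"
    by (simp only: nn_integral_fst[OF ek])
  have "AE z in \<nu>' \<Otimes>\<^sub>M \<nu>. \<forall>x. k (fst z, x) = f (fst z + x)" by (rule t.AE_fst[OF k(2)])
  then have "AE z in \<nu>' \<Otimes>\<^sub>M \<nu>. k z = f (fst z + snd z)" by eventually_elim (subst prod.collapse[symmetric], blast)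
  from t.AE_swap[OF this] have sw: "AE x in \<nu>. AE u in \<nu>'. k (u, x) = f (x + u)"
    by (simp add: add.commute)
  have "(\<integral>\<^sup>+x. \<integral>\<^sup>+u. ennreal (k (u, x)) \<partial>\<nu>' \<partial>\<nu>) = (\<integral>\<^sup>+x. (\<integral>\<^sup>+u. ennreal (f u) \<partial>\<nu>') \<partial>\<nu>)"
    using sw
  proof (intro nn_integral_cong_AE, eventually_elim)
    case (elim x)
    have "(\<integral>\<^sup>+u. ennreal (k (u, x)) \<partial>\<nu>') = (\<integral>\<^sup>+u. ennreal (f (x + u)) \<partial>\<nu>')"
      using elim by (intro nn_integral_cong_AE) auto
    also have "\<dots> = (\<integral>\<^sup>+u. ennreal (f u) \<partial>(distr \<nu>' borel ((+) x)))"
      using f_meas by (subst nn_integral_distr) auto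
    finally show ?case by (simp only: h.translation)
  qed
  also have "\<dots> = (\<integral>\<^sup>+x. ennreal (f x) \<partial>\<nu>')" using emeasure_space_1 by simp
  finally have "(\<integral>\<^sup>+z. ennreal (k z) \<partial>(\<nu>' \<Otimes>\<^sub>M \<nu>)) = (\<integral>\<^sup>+x. ennreal (f x) \<partial>\<nu>')"
    by (simp only: t.mn.nn_integral_snd[OF ek])
  with 1 show ?thesis by simp
qed

lemma haar_unique:
  assumes \<nu>': "compact_haar \<nu>'"
  shows "\<nu>' = \<nu>"
proof -
  interpret h: compact_haar \<nu>' by fact
  (* An inequality between the two measures suffices, since both have total mass 1 and the
     inequality also holds for complements. *)
  have K_le: "emeasure \<nu> K \<le> emeasure \<nu>' K" if K: "compact K" for K
  proof (rule ennreal_le_epsilon)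
    fix e :: real assume "0 < e"
    then obtain U where U: "open U" "K \<subseteq> U" "emeasure \<nu>' (U - K) < ennreal e"
      using h.outer_regular[OF borel_set[OF K]] by blast
    obtain f :: "'g \<Rightarrow> real" where f: "continuous_on UNIV f" "\<And>x. 0 \<le> f x" "\<And>x. f x \<le> 1"
       "\<And>x. x \<in> K \<Longrightarrow> f x = 1" "\<And>x. x \<notin> U \<Longrightarrow> f x = 0"
      using compact_open_separating_function[OF cpt K U(1,2)] by blast
    have "emeasure \<nu> K = (\<integral>\<^sup>+x. indicator K x \<partial>\<nu>)" using K by simp
    also have "\<dots> \<le> (\<integral>\<^sup>+x. ennreal (f x) \<partial>\<nu>)"
      using f(4) by (intro nn_integral_mono) (auto simp: indicator_def)
    also have "\<dots> = (\<integral>\<^sup>+x. ennreal (f x) \<partial>\<nu>')" by (rule continuous_integral_unique[OF \<nu>' f(1), symmetric])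
    also have "\<dots> \<le> (\<integral>\<^sup>+x. indicator U x \<partial>\<nu>')"
      using f(3,5) by (intro nn_integral_mono) (auto simp: indicator_def)
    also have "\<dots> = emeasure \<nu>' (K \<union> (U - K))" using U by (auto simp: Un_absorb1)
    also have "\<dots> \<le> emeasure \<nu>' K + emeasure \<nu>' (U - K)"
      using K U by (intro emeasure_subadditive) auto
    also have "\<dots> \<le> emeasure \<nu>' K + ennreal e" using U(3) by (intro add_left_mono less_imp_le)
    finally show "emeasure \<nu> K \<le> emeasure \<nu>' K + ennreal e" .
  qed
  have le: "emeasure \<nu> B \<le> emeasure \<nu>' B" if B: "B \<in> sets borel" for B
    unfolding inner_regular[OF B] h.inner_regular[OF B] by (intro SUP_mono) (use K_le in blast)
  show ?thesis
  proof (rule measure_eqI)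
    fix B assume "B \<in> sets \<nu>'"
    then have B: "B \<in> sets borel" "- B \<in> sets borel" by auto
    have "measure \<nu> (- B) = 1 - measure \<nu> B" "measure \<nu>' (- B) = 1 - measure \<nu>' B"
      using prob_compl[of B] h.prob_compl[of B] B by (auto simp: Compl_eq_Diff_UNIV)
    moreover have "measure \<nu> B \<le> measure \<nu>' B" "measure \<nu> (- B) \<le> measure \<nu>' (- B)"
      using le[OF B(1)] le[OF B(2)] by (auto simp: emeasure_eq_measure h.emeasure_eq_measure)
    ultimately show "emeasure \<nu>' B = emeasure \<nu> B"
      by (simp add: emeasure_eq_measure h.emeasure_eq_measure)
  qed simp
qed

lemma automorphism_preserves:
  assumes B: "B \<in> top_auts"
  shows "distr \<nu> borel B = \<nu>"
proof (rule haar_unique)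
  have bij: "bij B" and add: "\<And>x y. B (x + y) = B x + B y"
    and cont: "continuous_on UNIV B" "continuous_on UNIV (inv B)"
    using B by (auto simp: top_auts_def)
  have Bm [measurable]: "B \<in> borel \<rightarrow>\<^sub>M borel" by (intro borel_measurable_continuous_onI cont)
  have B\<nu>: "B \<in> \<nu> \<rightarrow>\<^sub>M borel" using Bm by simp
  interpret D: prob_space "distr \<nu> borel B" by (rule prob_space_distr[OF B\<nu>])
  have em: "emeasure (distr \<nu> borel B) S = emeasure \<nu> (B -` S)" if "S \<in> sets borel" for S
    using that by (subst emeasure_distr) auto
  show "compact_haar (distr \<nu> borel B)"
  proof unfold_locales
    show "compact (UNIV :: 'g set)" by (rule cpt)
    show "sets (distr \<nu> borel B) = sets borel" by simp
    fix a :: 'g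
    (* Translation by a after B is B after translation by the preimage of a. *)
    have aB: "a + B x = B (inv B a + x)" for x
      using bij add by (simp add: bij_is_surj surj_f_inv_f)
    have "distr (distr \<nu> borel B) borel ((+) a) = distr \<nu> borel (\<lambda>x. a + B x)"
      by (subst distr_distr) (auto simp: o_def)
    also have "\<dots> = distr \<nu> borel (\<lambda>x. B (inv B a + x))" by (simp only: aB)
    also have "\<dots> = distr (distr \<nu> borel ((+) (inv B a))) borel B"
      by (subst distr_distr) (auto simp: o_def)
    also have "\<dots> = distr \<nu> borel B" by (simp only: translation)
    finally show "distr (distr \<nu> borel B) borel ((+) a) = distr \<nu> borel B" .
  next
    fix S :: "'g set" assume S: "S \<in> sets borel"
    have BS: "B -` S \<in> sets borel" using measurable_sets_borel[OF Bm S] by simp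
    have "emeasure \<nu> (B -` S) \<le> (SUP K\<in>{K. compact K \<and> K \<subseteq> S}. emeasure (distr \<nu> borel B) K)"
      unfolding inner_regular[OF BS]
    proof (rule SUP_mono)
      fix K assume K: "K \<in> {K. compact K \<and> K \<subseteq> B -` S}"
      have "compact (B ` K)" using K continuous_on_subset[OF cont(1)] by (intro compact_continuous_image) auto
      moreover have "emeasure \<nu> K = emeasure (distr \<nu> borel B) (B ` K)"
        using em[of "B ` K"] \<open>compact (B ` K)\<close> bij by (simp add: bij_is_inj inj_vimage_image_eq)
      ultimately show "\<exists>K'\<in>{K. compact K \<and> K \<subseteq> S}. emeasure \<nu> K \<le> emeasure (distr \<nu> borel B) K'"
        using K by (intro bexI[of _ "B ` K"]) auto
    qed
    moreover have "(SUP K\<in>{K. compact K \<and> K \<subseteq> S}. emeasure (distr \<nu> borel B) K) \<le> emeasure (distr \<nu> borel B) S"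
      using S by (intro SUP_least emeasure_mono) auto
    ultimately show "emeasure (distr \<nu> borel B) S = (SUP K\<in>{K. compact K \<and> K \<subseteq> S}. emeasure (distr \<nu> borel B) K)"
      using em[OF S] by simp
  qed
qed

end

section \<open>Averages of a function over a family of measure-preserving maps\<close>

lemma powr_tangent_le:
  fixes a t q :: real
  assumes "1 \<le> q" "0 < a" "0 \<le> t"
  shows "a powr q + q * a powr (q - 1) * (t - a) \<le> t powr q"
proof (cases "t = 0")
  case True
  have "a powr q = a powr (q - 1) * a" using assms by (simp add: powr_mult_base mult.commute[of _ a])
  then have "a powr q + q * a powr (q - 1) * (t - a) = (1 - q) * a powr q" using True by (simp add: algebra_simps)
  also have "\<dots> \<le> 0" using assms by (intro mult_nonpos_nonneg) auto
  finally show ?thesis using True by simp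
next
  case False
  have "(q * a powr (q - 1)) * (t - a) \<le> t powr q - a powr q"
  proof (rule convex_on_imp_above_tangent[where A="{0<..}" and f="\<lambda>t. t powr q"])
    show "convex_on {0<..} (\<lambda>t. t powr q)" using assms(1) by (rule powr_convex)
    show "((\<lambda>t. t powr q) has_real_derivative q * a powr (q - 1)) (at a within {0<..})"
      by (rule has_field_derivative_at_within[OF has_real_derivative_powr[OF assms(2)]])
  qed (use assms False in \<open>auto simp: interior_open\<close>)
  then show ?thesis by simp
qed

text \<open>Jensen's inequality for \<open>t powr q\<close> on a finite measure space. The tangent at the mean value lies
  below the function on all of \<open>{0..}\<close>, including the value \<open>0\<close>, and is integrated.\<close>
lemma (in finite_measure) powr_integral_le:
  fixes h :: "'a \<Rightarrow> real"
  assumes q: "1 \<le> q" and h: "integrable M h" "\<And>u. 0 \<le> h u" and hq: "integrable M (\<lambda>u. h u powr q)"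
  shows "(LINT u|M. h u) powr q \<le> measure M (space M) powr (q - 1) * (LINT u|M. h u powr q)"
proof (cases "(LINT u|M. h u) = 0")
  case True
  then show ?thesis using q by (simp add: integral_nonneg_AE)
next
  case False
  define J where "J = (LINT u|M. h u)"
  define I where "I = measure M (space M)"
  have J: "0 < J" using False h(2) by (simp add: J_def less_le integral_nonneg_AE)
  have "I \<noteq> 0"
  proof
    assume "I = 0"
    then have "emeasure M (space M) = 0" by (simp add: I_def emeasure_eq_measure)
    then have "AE u in M. h u = 0" by (intro AE_I[where N="space M"]) auto
    then have "J = 0" unfolding J_def by (simp add: integral_eq_zero_AE)
    with J show False by simp
  qed
  then have I: "0 < I" by (simp add: I_def less_le)
  define a where "a = J / I"
  have a: "0 < a" using I J by (simp add: a_def)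
  have "(LINT u|M. a powr q + q * a powr (q - 1) * (h u - a)) \<le> (LINT u|M. h u powr q)"
    by (intro integral_mono powr_tangent_le q a h hq Bochner_Integration.integrable_add
          Bochner_Integration.integrable_diff integrable_mult_right integrable_const)
  also have "(LINT u|M. a powr q + q * a powr (q - 1) * (h u - a)) = I * a powr q + q * a powr (q - 1) * (J - I * a)"
    using h(1) by (simp add: J_def I_def)
  also have "J - I * a = 0" using I by (simp add: a_def)
  finally have le: "I * a powr q \<le> (LINT u|M. h u powr q)" by simp
  have "J powr q = I powr q * a powr q"
    using I J by (simp add: a_def powr_mult[symmetric])
  also have "I powr q = I powr (q - 1) * I" using I by (simp add: powr_mult_base mult.commute[of _ I])
  also have "I powr (q - 1) * I * a powr q \<le> I powr (q - 1) * (LINT u|M. h u powr q)"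
    using mult_left_mono[OF le, of "I powr (q - 1)"] by (simp add: mult.assoc)
  finally show ?thesis unfolding J_def I_def .
qed

context haar_flow
begin

lemma orbit_measurable [measurable]: "(\<lambda>u. T u x) \<in> m \<rightarrow>\<^sub>M borel"
proof (rule borel_measurableI)
  fix U :: "'g set" assume "open U"
  then have "{u \<in> space m. T u ` {x} \<subseteq> U} \<in> sets m" by (intro compact_open_sets) auto
  moreover have "{u \<in> space m. T u ` {x} \<subseteq> U} = (\<lambda>u. T u x) -` U \<inter> space m" by auto
  ultimately show "(\<lambda>u. T u x) -` U \<inter> space m \<in> sets m" by simp
qed

context
  fixes f :: "'g \<Rightarrow> complex" and k :: "'w \<times> 'g \<Rightarrow> complex" and s :: "'w \<Rightarrow> complex"
  assumes f_int: "integrable \<nu> f"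
    and k_meas: "k \<in> borel_measurable (m \<Otimes>\<^sub>M \<nu>)"
    and k_eq: "AE z in m \<Otimes>\<^sub>M \<nu>. k z = f (T (fst z) (snd z))"
    and s_meas: "s \<in> borel_measurable m" and s_le: "\<And>u. norm (s u) \<le> 1"
begin

text \<open>The average is formed with the product measurable representative \<open>k\<close> of \<open>f (T u x)\<close>, which makes
  it a Borel function of \<open>x\<close>; \<open>average_eq\<close> relates it to \<open>f (T u x)\<close>.\<close>
definition average :: "'g \<Rightarrow> complex" where
  "average x = (LINT u|m. s u * k (u, x))"

lemma f_meas: "f \<in> borel_measurable borel"
  using borel_measurable_integrable[OF f_int] by simp

lemma k_integrable: "integrable (m \<Otimes>\<^sub>M \<nu>) k"
proof (rule integrableI_bounded[OF k_meas])
  have "(\<integral>\<^sup>+z. ennreal (norm (k z)) \<partial>(m \<Otimes>\<^sub>M \<nu>)) = emeasure m (space m) * (\<integral>\<^sup>+x. ennreal (norm (f x)) \<partial>\<nu>)"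
    by (rule Tonelli_compose(2)[OF k_meas k_eq _ f_meas]) simp
  also have "\<dots> < \<infinity>"
    using f_int by (simp add: integrable_iff_bounded ennreal_mult_less_top m.emeasure_eq_measure)
  finally show "(\<integral>\<^sup>+z. ennreal (norm (k z)) \<partial>(m \<Otimes>\<^sub>M \<nu>)) < \<infinity>" .
qed

lemma weighted_integrable:
  assumes c: "c \<in> borel_measurable borel" "\<And>x. norm (c x) \<le> (1::real)"
  shows "integrable (m \<Otimes>\<^sub>M \<nu>) (\<lambda>z. s (fst z) * k z * c (snd z))"
proof (rule Bochner_Integration.integrable_bound[OF k_integrable])
  have "(\<lambda>z. s (fst z)) \<in> borel_measurable (m \<Otimes>\<^sub>M \<nu>)"
    by (rule measurable_compose[OF measurable_fst s_meas])
  moreover have "(\<lambda>z. c (snd z)) \<in> borel_measurable (m \<Otimes>\<^sub>M \<nu>)"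
    by (rule measurable_compose[OF snd_borel c(1)])
  ultimately show "(\<lambda>z. s (fst z) * k z * c (snd z)) \<in> borel_measurable (m \<Otimes>\<^sub>M \<nu>)"
    using k_meas by (intro borel_measurable_times)
  have "norm (s u * y * c x) \<le> norm y" for u y x
  proof -
    have "norm (s u) * norm y * norm (c x) \<le> 1 * norm y * 1"
      by (intro mult_mono s_le c(2)) auto
    then show ?thesis by (simp add: norm_mult)
  qed
  then show "AE z in m \<Otimes>\<^sub>M \<nu>. norm (s (fst z) * k z * c (snd z)) \<le> norm (k z)" by simp
qed

lemma slice_integrable: "AE x in \<nu>. integrable m (\<lambda>u. k (u, x))"
  using mn.AE_integrable_snd[of "\<lambda>u x. k (u, x)"] k_integrable by simp

lemma slice_measurable: "(\<lambda>u. k (u, x)) \<in> borel_measurable m"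
  by (rule measurable_compose[OF measurable_Pair2' k_meas]) simp

lemma average_measurable: "average \<in> borel_measurable borel"
proof -
  have "(\<lambda>z. s (fst z) * k z) \<in> borel_measurable (m \<Otimes>\<^sub>M \<nu>)"
    using weighted_integrable[of "\<lambda>_. 1"] by (simp add: borel_measurable_integrable)
  from measurable_pair_swap[OF this]
  have "(\<lambda>(x, u). s u * k (u, x)) \<in> borel_measurable (\<nu> \<Otimes>\<^sub>M m)"
    by (simp add: case_prod_beta')
  from m.borel_measurable_lebesgue_integral[OF this] show ?thesis
    unfolding average_def[abs_def] by simp
qed

lemma average_eq:
  "AE x in \<nu>. integrable m (\<lambda>u. f (T u x)) \<and> average x = (LINT u|m. s u * f (T u x))"
  using slice_integrable AE_swap[OF k_eq]
proof eventually_elim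
  case (elim x)
  have fT: "(\<lambda>u. f (T u x)) \<in> borel_measurable m"
    by (rule measurable_compose[OF orbit_measurable f_meas])
  have ae: "AE u in m. k (u, x) = f (T u x)" using elim(2) by simp
  have "integrable m (\<lambda>u. f (T u x))"
    using elim(1) integrable_cong_AE[OF slice_measurable fT ae] by simp
  moreover have "(LINT u|m. s u * k (u, x)) = (LINT u|m. s u * f (T u x))"
    using ae fT slice_measurable s_meas by (intro integral_cong_AE borel_measurable_times) auto
  ultimately show ?case by (simp add: average_def)
qed

lemma norm_average_le: "norm (average x) \<le> (LINT u|m. norm (k (u, x)))"
  if "integrable m (\<lambda>u. k (u, x))"
proof -
  have "norm (average x) \<le> (LINT u|m. norm (s u * k (u, x)))"
    unfolding average_def by (rule integral_norm_bound)
  also have "\<dots> \<le> (LINT u|m. norm (k (u, x)))"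
    using that by (intro integral_mono_AE' integrable_norm)
      (auto simp: norm_mult intro!: AE_I2 mult_left_le_one_le s_le)
  finally show ?thesis .
qed

lemma average_essentially_bounded:
  assumes "AE x in \<nu>. norm (f x) \<le> c"
  shows "AE x in \<nu>. norm (average x) \<le> measure m (space m) * c"
proof -
  have N: "{x. c < norm (f x)} \<in> sets borel" using f_meas by measurable
  have "emeasure \<nu> {x. c < norm (f x)} = 0"
    using assms AE_iff_measurable[of "{x. c < norm (f x)}" \<nu> "\<lambda>x. norm (f x) \<le> c"] N
    by (simp add: not_le)
  from null_set_vimage[OF N this] k_eq
  have "AE z in m \<Otimes>\<^sub>M \<nu>. norm (k z) \<le> c" by eventually_elim auto
  from slice_integrable AE_swap[OF this] show ?thesis
  proof eventually_elim
    case (elim x)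
    have "norm (average x) \<le> (LINT u|m. norm (k (u, x)))" using elim(1) by (rule norm_average_le)
    also have "\<dots> \<le> (LINT u|m. c)" using elim by (intro integral_mono_AE integrable_norm) auto
    finally show ?case by simp
  qed
qed

text \<open>Jensen's inequality at a fixed \<open>x\<close> costs the factor \<open>m(\<Omega>) powr (q - 1)\<close>, and Tonelli's theorem
  contributes one more factor \<open>m(\<Omega>)\<close>.\<close>
lemma average_powr:
  assumes q: "1 \<le> q" and fq: "integrable \<nu> (\<lambda>x. norm (f x) powr q)"
  shows "integrable \<nu> (\<lambda>x. norm (average x) powr q)"
    and "(LINT x|\<nu>. norm (average x) powr q) \<le> measure m (space m) powr q * (LINT x|\<nu>. norm (f x) powr q)"
proof -
  define I where "I = measure m (space m)"
  define F where "F = (LINT x|\<nu>. norm (f x) powr q)"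
  have I0: "0 \<le> I" and F0: "0 \<le> F" by (auto simp: I_def F_def integral_nonneg_AE)
  have w: "(\<lambda>y::complex. ennreal (norm y powr q)) \<in> borel_measurable borel" by measurable
  have "(\<integral>\<^sup>+x. ennreal (norm (f x) powr q) \<partial>\<nu>) = ennreal F"
    unfolding F_def by (rule nn_integral_eq_integral[OF fq]) simp
  with Tonelli_compose(1)[OF k_meas k_eq w f_meas]
  have dbl: "(\<integral>\<^sup>+x. \<integral>\<^sup>+u. ennreal (norm (k (u, x)) powr q) \<partial>m \<partial>\<nu>) = ennreal (I * F)"
    using I0 by (simp add: m.emeasure_eq_measure I_def ennreal_mult')
  have inner_meas: "(\<lambda>x. \<integral>\<^sup>+u. ennreal (norm (k (u, x)) powr q) \<partial>m) \<in> borel_measurable \<nu>"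
    using measurable_compose[OF measurable_pair_swap[OF k_meas] w]
    by (intro m.borel_measurable_nn_integral) (simp add: case_prod_beta')
  have "AE x in \<nu>. (\<integral>\<^sup>+u. ennreal (norm (k (u, x)) powr q) \<partial>m) \<noteq> \<infinity>"
    using dbl by (intro nn_integral_PInf_AE inner_meas) simp
  with slice_integrable
  have "AE x in \<nu>. ennreal (norm (average x) powr q) \<le>
      ennreal (I powr (q - 1)) * (\<integral>\<^sup>+u. ennreal (norm (k (u, x)) powr q) \<partial>m)"
  proof eventually_elim
    case (elim x)
    have kq: "integrable m (\<lambda>u. norm (k (u, x)) powr q)"
      using elim(2) slice_measurable[of x] by (intro integrableI_bounded) (auto simp: less_top)
    have "norm (average x) powr q \<le> (LINT u|m. norm (k (u, x))) powr q"
      using norm_average_le[OF elim(1)] q by (intro powr_mono2) auto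
    also have "\<dots> \<le> I powr (q - 1) * (LINT u|m. norm (k (u, x)) powr q)"
      unfolding I_def using elim(1) by (intro m.powr_integral_le q kq integrable_norm) auto
    finally have "ennreal (norm (average x) powr q) \<le> ennreal (I powr (q - 1)) * ennreal (LINT u|m. norm (k (u, x)) powr q)"
      by (simp add: ennreal_mult[symmetric] integral_nonneg_AE ennreal_leI)
    then show ?case using nn_integral_eq_integral[OF kq] by simp
  qed
  then have "(\<integral>\<^sup>+x. ennreal (norm (average x) powr q) \<partial>\<nu>) \<le>
      (\<integral>\<^sup>+x. ennreal (I powr (q - 1)) * (\<integral>\<^sup>+u. ennreal (norm (k (u, x)) powr q) \<partial>m) \<partial>\<nu>)"
    by (rule nn_integral_mono_AE)
  also have "\<dots> = ennreal (I powr (q - 1)) * ennreal (I * F)"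
    by (subst nn_integral_cmult[OF inner_meas]) (simp only: dbl)
  also have "\<dots> = ennreal (I * I powr (q - 1) * F)"
    using I0 F0 by (simp add: ennreal_mult[symmetric] mult_ac)
  also have "I * I powr (q - 1) = I powr q" using I0 by (simp add: powr_mult_base)
  finally have le: "(\<integral>\<^sup>+x. ennreal (norm (average x) powr q) \<partial>\<nu>) \<le> ennreal (I powr q * F)" .
  have av: "(\<lambda>x. norm (average x) powr q) \<in> borel_measurable \<nu>"
    using average_measurable by simp
  show int: "integrable \<nu> (\<lambda>x. norm (average x) powr q)"
    using av le by (intro integrableI_bounded) (auto intro: le_less_trans)
  show "(LINT x|\<nu>. norm (average x) powr q) \<le> measure m (space m) powr q * (LINT x|\<nu>. norm (f x) powr q)"
    using le nn_integral_eq_integral[OF int] F0 by (simp add: I_def F_def)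
qed

lemma average_pairing_zero:
  assumes c: "c \<in> borel_measurable borel" "\<And>x. norm (c x) \<le> (1::real)"
    and zero: "AE u in m. (LINT x|\<nu>. f (T u x) * c x) = 0"
  shows "(LINT x|\<nu>. average x * c x) = 0"
proof -
  have "(LINT x|\<nu>. average x * c x) = (LINT x|\<nu>. LINT u|m. s u * k (u, x) * c x)"
    by (simp add: average_def)
  also have "\<dots> = (LINT u|m. LINT x|\<nu>. s u * k (u, x) * c x)"
    using weighted_integrable[OF c] by (intro mn.Fubini_integral) (simp add: case_prod_beta')
  also have "\<dots> = (LINT u|m. 0)"
  proof (rule integral_cong_AE)
    have "(\<lambda>(u, x). s u * k (u, x) * c x) \<in> borel_measurable (m \<Otimes>\<^sub>M \<nu>)"
      using borel_measurable_integrable[OF weighted_integrable[OF c]] by (simp add: case_prod_beta')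
    then show "(\<lambda>u. LINT x|\<nu>. s u * k (u, x) * c x) \<in> borel_measurable m"
      by (rule borel_measurable_lebesgue_integral)
    show "AE u in m. (LINT x|\<nu>. s u * k (u, x) * c x) = 0"
      using mn.AE_pair[OF k_eq] zero AE_space
    proof eventually_elim
      case (elim u)
      have ku: "(\<lambda>x. k (u, x)) \<in> borel_measurable borel"
        using measurable_compose[OF measurable_Pair1' k_meas] elim(3) by simp
      have fu: "(\<lambda>x. f (T u x)) \<in> borel_measurable borel"
        by (rule measurable_compose[OF map_measurable[OF elim(3)] f_meas])
      have "(LINT x|\<nu>. k (u, x) * c x) = (LINT x|\<nu>. f (T u x) * c x)"
        using elim(1) ku fu c(1) by (intro integral_cong_AE) auto
      then have "(LINT x|\<nu>. k (u, x) * c x) = 0" using elim(2) by simp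
      then show ?case by (simp add: mult.assoc)
    qed
  qed simp
  finally show ?thesis by simp
qed

end

end

section \<open>Lebesgue norms on a probability space\<close>

context prob_space
begin

lemma enn2real_exponent: "1 \<le> (p::ennreal) \<Longrightarrow> p \<noteq> \<infinity> \<Longrightarrow> 1 \<le> enn2real p"
  by (cases p) (auto simp: ennreal_1[symmetric] simp del: ennreal_1)

text \<open>This needs positive total mass: on a null space the essential supremum is \<open>-\<infinity>\<close>.\<close>
lemma esssup_norm_nonneg:
  fixes f :: "'a \<Rightarrow> complex"
  shows "0 \<le> esssup M (\<lambda>x. ereal (norm (f x)))"
proof -
  have "esssup M (\<lambda>x. 0 :: ereal) \<le> esssup M (\<lambda>x. ereal (norm (f x)))"
    by (rule esssup_mono) auto
  then show ?thesis using esssup_const[of M "0::ereal"] emeasure_space_1 by simp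
qed

lemma Lp_infinity_essentially_bounded:
  assumes "f \<in> Lp_set \<infinity> M"
  shows "AE x in M. norm (f x) \<le> Lp_norm \<infinity> M f"
proof -
  let ?e = "esssup M (\<lambda>x. ereal (norm (f x)))"
  have "?e < \<infinity>" "0 \<le> ?e" using assms esssup_norm_nonneg by (auto simp: Lp_set_def)
  then have "?e = ereal (Lp_norm \<infinity> M f)" by (cases ?e) (auto simp: Lp_norm_def)
  moreover have "AE x in M. ereal (norm (f x)) \<le> ?e" by (rule esssup_AE)
  ultimately show ?thesis by simp
qed

lemma Lp_infinityI:
  assumes f: "f \<in> borel_measurable M" and c: "AE x in M. norm (f x) \<le> c"
  shows "f \<in> Lp_set \<infinity> M" and "Lp_norm \<infinity> M f \<le> c"
proof -
  let ?e = "esssup M (\<lambda>x. ereal (norm (f x)))"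
  have "?e \<le> ereal c" using c f by (intro esssup_I) auto
  moreover have "0 \<le> ?e" by (rule esssup_norm_nonneg)
  ultimately have "?e < \<infinity>" "real_of_ereal ?e \<le> c" by (cases ?e; auto)+
  then show "f \<in> Lp_set \<infinity> M" "Lp_norm \<infinity> M f \<le> c" using f by (auto simp: Lp_set_def Lp_norm_def)
qed

lemma Lp_set_integrable:
  assumes f: "f \<in> Lp_set p M" and p: "1 \<le> p"
  shows "integrable M f"
proof (cases "p = \<infinity>")
  case True
  then show ?thesis
    using f Lp_infinity_essentially_bounded[of f] by (intro integrable_const_bound) (auto simp: Lp_set_def)
next
  case False
  then have q: "1 \<le> enn2real p" and fm: "f \<in> borel_measurable M"
      and fq: "integrable M (\<lambda>x. norm (f x) powr enn2real p)"
    using f p enn2real_exponent by (auto simp: Lp_set_def)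
  have "integrable M (\<lambda>x. 1 + norm (f x) powr enn2real p)" using fq by simp
  then show ?thesis
  proof (rule Bochner_Integration.integrable_bound[OF _ fm], intro AE_I2)
    fix x
    show "norm (f x) \<le> norm (1 + norm (f x) powr enn2real p)"
    proof (cases "norm (f x) \<le> 1")
      case True
      then show ?thesis by (simp add: add_increasing2)
    next
      case False
      then have "norm (f x) powr 1 \<le> norm (f x) powr enn2real p" using q by (intro powr_mono) auto
      then show ?thesis using False by simp
    qed
  qed
qed

lemma zero_in_Lp: "(\<lambda>_. 0) \<in> Lp_set p M" and Lp_norm_zero: "Lp_norm p M (\<lambda>_. 0) \<le> 0"
  using Lp_infinityI[of "\<lambda>_. 0" 0] by (auto simp: Lp_set_def Lp_norm_def split: if_splits)

lemma Lp_norm_cong_AE: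
  assumes "f \<in> borel_measurable M" "g \<in> borel_measurable M" "AE x in M. f x = g x"
  shows "Lp_norm p M f = Lp_norm p M g"
proof -
  have "esssup M (\<lambda>x. ereal (norm (f x))) = esssup M (\<lambda>x. ereal (norm (g x)))"
    using assms by (intro esssup_AE_cong) auto
  moreover have "(LINT x|M. norm (f x) powr enn2real p) = (LINT x|M. norm (g x) powr enn2real p)"
    using assms by (intro integral_cong_AE) auto
  ultimately show ?thesis by (simp add: Lp_norm_def)
qed

end

lemma (in haar_flow) average_Lp:
  assumes f: "f \<in> Lp_set p \<nu>" and p: "1 \<le> p"
    and k: "k \<in> borel_measurable (m \<Otimes>\<^sub>M \<nu>)" "AE z in m \<Otimes>\<^sub>M \<nu>. k z = f (T (fst z) (snd z))"
    and s: "s \<in> borel_measurable m" "\<And>u. norm (s u) \<le> 1"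
  shows "average k s \<in> Lp_set p \<nu>"
    and "Lp_norm p \<nu> (average k s) \<le> measure m (space m) * Lp_norm p \<nu> f"
proof -
  have f_int: "integrable \<nu> f" using f p by (rule Lp_set_integrable)
  have av: "average k s \<in> borel_measurable \<nu>"
    using average_measurable[OF f_int k s] by simp
  have "average k s \<in> Lp_set p \<nu> \<and> Lp_norm p \<nu> (average k s) \<le> measure m (space m) * Lp_norm p \<nu> f"
  proof (cases "p = \<infinity>")
    case True
    with f have "AE x in \<nu>. norm (f x) \<le> Lp_norm p \<nu> f"
      using Lp_infinity_essentially_bounded by simp
    from average_essentially_bounded[OF f_int k s this] show ?thesis
      unfolding True using Lp_infinityI[OF av] by blast
  next
    case False
    let ?q = "enn2real p"
    let ?I = "measure m (space m)"
    have q: "1 \<le> ?q" and fq: "integrable \<nu> (\<lambda>x. norm (f x) powr ?q)"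
      using f p False enn2real_exponent by (auto simp: Lp_set_def)
    note avq = average_powr[OF f_int k s q fq]
    have "(LINT x|\<nu>. norm (average k s x) powr ?q) powr (1 / ?q)
        \<le> (?I powr ?q * (LINT x|\<nu>. norm (f x) powr ?q)) powr (1 / ?q)"
      using q by (intro powr_mono2 avq(2)) (auto intro!: integral_nonneg_AE)
    also have "\<dots> = ?I * (LINT x|\<nu>. norm (f x) powr ?q) powr (1 / ?q)"
      using q by (subst powr_mult) (auto simp: powr_powr intro!: integral_nonneg_AE)
    finally show ?thesis using False av avq(1) by (auto simp: Lp_set_def Lp_norm_def)
  qed
  then show "average k s \<in> Lp_set p \<nu>" "Lp_norm p \<nu> (average k s) \<le> measure m (space m) * Lp_norm p \<nu> f"
    by auto
qed

section \<open>Hausdorff operators as averages\<close>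

lemma normalized_haar_compact_haar:
  fixes \<nu> :: "'g::{topological_ab_group_add,t2_space} measure"
  assumes "compact (UNIV :: 'g set)" "normalized_haar \<nu>"
  shows "compact_haar \<nu>"
  using assms unfolding normalized_haar_def compact_haar_def compact_haar_axioms_def by blast

lemma integrable_norm_density_iff:
  fixes \<Phi> h :: "'w \<Rightarrow> complex"
  assumes \<Phi>: "\<Phi> \<in> borel_measurable M" and h: "h \<in> borel_measurable M"
  shows "integrable (density M (\<lambda>u. ennreal (norm (\<Phi> u)))) h \<longleftrightarrow> integrable M (\<lambda>u. \<Phi> u * h u)"
proof -
  have "integrable (density M (\<lambda>u. ennreal (norm (\<Phi> u)))) h \<longleftrightarrow> integrable M (\<lambda>u. norm (\<Phi> u) *\<^sub>R h u)"
    using \<Phi> h by (intro integrable_density) auto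
  also have "\<dots> \<longleftrightarrow> integrable M (\<lambda>u. norm (norm (\<Phi> u) *\<^sub>R h u))"
    using \<Phi> h by (intro integrable_norm_iff[symmetric]) auto
  also have "\<dots> \<longleftrightarrow> integrable M (\<lambda>u. norm (\<Phi> u * h u))" by (simp add: norm_mult)
  also have "\<dots> \<longleftrightarrow> integrable M (\<lambda>u. \<Phi> u * h u)"
    using \<Phi> h by (intro integrable_norm_iff) auto
  finally show ?thesis .
qed

text \<open>Polar decomposition \<open>\<Phi> = |\<Phi>| sgn \<Phi>\<close> turns the complex weight into a positive finite measure and
  a bounded factor.\<close>
lemma integral_norm_density_sgn:
  fixes \<Phi> h :: "'w \<Rightarrow> complex"
  assumes \<Phi>: "\<Phi> \<in> borel_measurable M" and h: "h \<in> borel_measurable M"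
  shows "(LINT u|density M (\<lambda>u. ennreal (norm (\<Phi> u))). sgn (\<Phi> u) * h u) = (LINT u|M. \<Phi> u * h u)"
proof -
  have s: "(\<lambda>u. sgn (\<Phi> u)) \<in> borel_measurable M" using \<Phi> by simp
  have "(LINT u|density M (\<lambda>u. ennreal (norm (\<Phi> u))). sgn (\<Phi> u) * h u)
      = (LINT u|M. norm (\<Phi> u) *\<^sub>R (sgn (\<Phi> u) * h u))"
    using \<Phi> h s by (intro integral_density) auto
  also have "\<dots> = (LINT u|M. \<Phi> u * h u)"
    by (intro Bochner_Integration.integral_cong) (auto simp: sgn_div_norm scaleR_conv_of_real)
  finally show ?thesis .
qed

text \<open>Strong measurability provides countable nets on sets of finite measure. The sets where
  \<open>|\<Phi>|\<close> is at least \<open>1 / (n + 1)\<close> have finite measure by Markov's inequality, and together they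
  carry the measure with density \<open>|\<Phi>|\<close>, so the union of their nets serves for that measure.\<close>
lemma automorphism_family_flow:
  fixes \<nu> :: "'g::{topological_ab_group_add,t2_space} measure" and \<Phi> :: "'w \<Rightarrow> complex"
  assumes \<nu>: "compact_haar \<nu>" and A: "aut_measurable M A" and \<Phi>: "integrable M \<Phi>"
  shows "haar_flow \<nu> (density M (\<lambda>u. ennreal (norm (\<Phi> u)))) A"
proof -
  interpret compact_haar \<nu> by fact
  let ?m = "density M (\<lambda>u. ennreal (norm (\<Phi> u)))"
  have \<Phi>m [measurable]: "\<Phi> \<in> borel_measurable M" using \<Phi> by (rule borel_measurable_integrable)
  have A_meas: "A \<in> M \<rightarrow>\<^sub>M aut_borel" using A by (simp add: aut_measurable_def)
  have A_aut: "A u \<in> top_auts" if "u \<in> space M" for u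
    using measurable_space[OF A_meas that] by simp
  have fin: "emeasure ?m (space ?m) < \<infinity>"
  proof -
    have "emeasure ?m (space ?m) = (\<integral>\<^sup>+u. ennreal (norm (\<Phi> u)) \<partial>M)"
      by (subst emeasure_density) (auto intro!: nn_integral_cong)
    then show ?thesis using \<Phi> by (simp add: integrable_iff_bounded)
  qed
  then interpret m: finite_measure ?m by (intro finite_measureI) simp
  show ?thesis
  proof unfold_locales
    fix K U :: "'g set" assume K: "compact K" "open U"
    let ?S = "{B \<in> top_auts. B ` K \<subseteq> U}"
    have "openin aut_topology ?S"
      unfolding aut_topology_def using K by (intro topology_generated_by_Basis) blast
    then have "?S \<in> sets aut_borel"
      unfolding aut_borel_def using aut_topology_space by (intro in_measure_of) auto
    from measurable_sets[OF A_meas this] have "A -` ?S \<inter> space M \<in> sets M" .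
    moreover have "A -` ?S \<inter> space M = {u \<in> space ?m. A u ` K \<subseteq> U}" using A_aut by auto
    ultimately show "{u \<in> space ?m. A u ` K \<subseteq> U} \<in> sets ?m" by simp
  next
    fix W :: "'g set" assume W: "open W" "0 \<in> W"
    define E where "E n = {u \<in> space M. inverse (real (Suc n)) \<le> norm (\<Phi> u)}" for n
    have E: "E n \<in> sets M" for n unfolding E_def by measurable
    have E_fin: "emeasure M (E n) < \<infinity>" for n
    proof -
      have "emeasure M {u \<in> space M. inverse (real (Suc n)) \<le> norm (\<Phi> u)}
          \<le> ennreal (1 / inverse (real (Suc n)) * (LINT u|M. norm (\<Phi> u)))"
        using \<Phi> by (intro integral_Markov_inequality integrable_norm) auto
      then show ?thesis unfolding E_def by (rule le_less_trans) simp
    qed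
    have "\<exists>D\<subseteq>top_auts. countable D \<and> (AE u in M. u \<in> E n \<longrightarrow> (\<exists>B\<in>D. \<forall>x. A u x - B x \<in> W))" for n
      using A E E_fin W unfolding aut_measurable_def by blast
    then have "\<exists>D. \<forall>n. D n \<subseteq> top_auts \<and> countable (D n) \<and>
        (AE u in M. u \<in> E n \<longrightarrow> (\<exists>B\<in>D n. \<forall>x. A u x - B x \<in> W))"
      by (intro choice allI)
    then obtain D where D: "\<forall>n. D n \<subseteq> top_auts \<and> countable (D n) \<and>
        (AE u in M. u \<in> E n \<longrightarrow> (\<exists>B\<in>D n. \<forall>x. A u x - B x \<in> W))" ..
    have "AE u in M. \<forall>n. u \<in> E n \<longrightarrow> (\<exists>B\<in>D n. \<forall>x. A u x - B x \<in> W)"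
      unfolding AE_all_countable using D by blast
    then have "AE u in M. 0 < ennreal (norm (\<Phi> u)) \<longrightarrow> (\<exists>B\<in>(\<Union>n. D n). \<forall>x. A u x - B x \<in> W)"
      using AE_space
    proof eventually_elim
      case (elim u)
      show ?case
      proof
        assume "0 < ennreal (norm (\<Phi> u))"
        then have "0 < norm (\<Phi> u)" by simp
        then obtain n where "inverse (real (Suc n)) < norm (\<Phi> u)" using reals_Archimedean by blast
        then have "u \<in> E n" using elim(2) unfolding E_def by simp
        with elim(1) show "\<exists>B\<in>(\<Union>n. D n). \<forall>x. A u x - B x \<in> W" by blast
      qed
    qed
    then have "AE u in ?m. \<exists>B\<in>(\<Union>n. D n). \<forall>x. A u x - B x \<in> W"
      by (subst AE_density) auto
    moreover have "countable (\<Union>n. D n)" using D by blast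
    moreover have "\<forall>B\<in>(\<Union>n. D n). continuous_on UNIV B"
      using D unfolding top_auts_def by blast
    ultimately show "\<exists>D. countable D \<and> (\<forall>B\<in>D. continuous_on UNIV B) \<and> (AE u in ?m. \<exists>B\<in>D. \<forall>x. A u x - B x \<in> W)"
      by blast
  next
    fix u assume "u \<in> space ?m"
    then have B: "A u \<in> top_auts" using A_aut by simp
    then show "continuous_on UNIV (A u)" by (simp add: top_auts_def)
    show "distr \<nu> borel (A u) = \<nu>" using B by (rule automorphism_preserves)
  qed
qed

section \<open>Fourier coefficients\<close>

text \<open>Translating by a point \<open>a\<close> with \<open>\<gamma> a \<noteq> 1\<close> multiplies the mean of \<open>\<gamma>\<close> by a constant other
  than \<open>1\<close> without changing it.\<close>
lemma (in compact_haar) fourier_coeff_one: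
  assumes \<gamma>: "\<gamma> \<in> characters" "\<gamma> \<noteq> (\<lambda>_. 1)"
  shows "fourier_coeff \<nu> (\<lambda>_. 1) \<gamma> = 0"
proof -
  have cont: "continuous_on UNIV \<gamma>" and add: "\<And>x y. \<gamma> (x + y) = \<gamma> x * \<gamma> y"
    using \<gamma>(1) by (auto simp: characters_def)
  have cm: "(\<lambda>x. cnj (\<gamma> x)) \<in> borel_measurable borel"
    by (intro borel_measurable_continuous_onI continuous_on_cnj cont)
  obtain a where a: "\<gamma> a \<noteq> 1" using \<gamma>(2) by auto
  have "(LINT x|\<nu>. cnj (\<gamma> x)) = (LINT x|distr \<nu> borel ((+) a). cnj (\<gamma> x))"
    by (simp only: translation)
  also have "\<dots> = (LINT x|\<nu>. cnj (\<gamma> (a + x)))"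
    using cm by (intro integral_distr) auto
  also have "\<dots> = cnj (\<gamma> a) * (LINT x|\<nu>. cnj (\<gamma> x))" by (simp add: add)
  finally have "(1 - cnj (\<gamma> a)) * (LINT x|\<nu>. cnj (\<gamma> x)) = 0" by (simp add: algebra_simps)
  moreover have "cnj (\<gamma> a) \<noteq> 1" using a by (metis complex_cnj_cnj complex_cnj_one)
  ultimately show ?thesis by (simp add: fourier_coeff_def)
qed

lemma one_in_positive_cone:
  assumes "character_order r"
  shows "(\<lambda>_. 1) \<in> positive_cone r"
proof -
  have "(\<lambda>_. 1) \<in> characters" by (simp add: characters_def)
  then show ?thesis using assms
    by (auto simp: positive_cone_def character_order_def linear_order_on_def partial_order_on_def
        preorder_on_def refl_on_def)
qed

lemma (in compact_haar) one_in_Hp: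
  assumes "character_order r"
  shows "(\<lambda>_. 1) \<in> Hp_set p \<nu> r"
  using fourier_coeff_one one_in_positive_cone[OF assms] Lp_infinityI[of "\<lambda>_. 1" 1]
  by (auto simp: Hp_set_def Lp_set_def)

text \<open>The dual map is onto, so \<open>\<gamma> = \<psi> \<circ> B\<close>, and as it preserves positivity, \<open>\<psi>\<close> is not positive
  when \<open>\<gamma>\<close> is not. Invariance of \<open>\<nu>\<close> under \<open>B\<close> turns the coefficient of \<open>f \<circ> B\<close> at \<open>\<gamma>\<close> into that of
  \<open>f\<close> at \<open>\<psi>\<close>.\<close>
lemma (in compact_haar) fourier_coeff_compose_plus:
  assumes B: "B \<in> top_auts_plus r" and f: "f \<in> Hp_set p \<nu> r"
    and \<gamma>: "\<gamma> \<in> characters - positive_cone r"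
  shows "fourier_coeff \<nu> (\<lambda>x. f (B x)) \<gamma> = 0"
proof -
  have Ba: "B \<in> top_auts" and bij: "bij_betw (dual_map B) characters characters"
      and pos: "dual_map B ` positive_cone r \<subseteq> positive_cone r"
    using B by (auto simp: top_auts_plus_def character_auts_plus_def)
  obtain \<psi> where \<psi>: "\<psi> \<in> characters" "\<gamma> = dual_map B \<psi>"
    using bij \<gamma> unfolding bij_betw_def by blast
  then have "\<psi> \<in> characters - positive_cone r" using pos \<gamma> by blast
  then have 0: "(LINT x|\<nu>. f x * cnj (\<psi> x)) = 0"
    using f by (auto simp: Hp_set_def fourier_coeff_def)
  have "f \<in> borel_measurable \<nu>" using f by (simp add: Hp_set_def Lp_set_def)
  then have fm: "f \<in> borel_measurable borel" by simp
  have \<psi>m: "(\<lambda>x. cnj (\<psi> x)) \<in> borel_measurable borel"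
    using \<psi>(1) by (intro borel_measurable_continuous_onI continuous_on_cnj) (simp add: characters_def)
  have Bm: "B \<in> \<nu> \<rightarrow>\<^sub>M borel"
    using Ba borel_measurable_continuous_onI[of B] by (simp add: top_auts_def)
  have "(LINT x|\<nu>. f x * cnj (\<psi> x)) = (LINT x|distr \<nu> borel B. f x * cnj (\<psi> x))"
    by (simp only: automorphism_preserves[OF Ba])
  also have "\<dots> = (LINT x|\<nu>. f (B x) * cnj (\<psi> (B x)))"
    by (intro integral_distr[OF Bm] borel_measurable_times fm \<psi>m)
  finally show ?thesis using 0 \<psi>(2) by (simp add: fourier_coeff_def dual_map_def)
qed

section \<open>Boundedness on Hardy spaces\<close>

lemma hausdorff_integrable_bounds:
  fixes \<nu> :: "'g::{topological_ab_group_add,t2_space} measure" and \<Phi> :: "'w \<Rightarrow> complex"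
  assumes \<nu>: "compact_haar \<nu>" and A: "aut_measurable M A" "AE u in M. A u \<in> top_auts_plus r"
    and \<Phi>: "integrable M \<Phi>" and p: "1 \<le> p" and f: "f \<in> Hp_set p \<nu> r"
  shows "\<exists>g\<in>Hp_set p \<nu> r. hausdorff_image \<nu> M \<Phi> A f g \<and>
           Lp_norm p \<nu> g \<le> (LINT u|M. norm (\<Phi> u)) * Lp_norm p \<nu> f"
proof -
  let ?m = "density M (\<lambda>u. ennreal (norm (\<Phi> u)))"
  interpret haar_flow \<nu> ?m A using \<nu> A(1) \<Phi> by (rule automorphism_family_flow)
  have \<Phi>m: "\<Phi> \<in> borel_measurable M" using \<Phi> by (rule borel_measurable_integrable)
  have fL: "f \<in> Lp_set p \<nu>" using f by (simp add: Hp_set_def)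
  have f_int: "integrable \<nu> f" using fL p by (rule Lp_set_integrable)
  have fm: "f \<in> borel_measurable borel" using borel_measurable_integrable[OF f_int] by simp
  have s: "(\<lambda>u. sgn (\<Phi> u)) \<in> borel_measurable ?m" "\<And>u. norm (sgn (\<Phi> u)) \<le> 1"
    using \<Phi>m by (auto simp: norm_sgn)
  obtain k where k: "k \<in> borel_measurable (?m \<Otimes>\<^sub>M \<nu>)"
      "AE z in ?m \<Otimes>\<^sub>M \<nu>. k z = f (A (fst z) (snd z))"
    using compose_ae_product_measurable[OF fm] by blast
  define g where "g = average k (\<lambda>u. sgn (\<Phi> u))"
  have mass: "measure ?m (space ?m) = (LINT u|M. norm (\<Phi> u))"
  proof -
    have "measure ?m (space ?m) = (LINT u|?m. 1)" by simp
    also have "\<dots> = (LINT u|M. norm (\<Phi> u) *\<^sub>R 1)"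
      using \<Phi>m by (intro integral_density) auto
    finally show ?thesis by simp
  qed
  have "hausdorff_image \<nu> M \<Phi> A f g"
    unfolding hausdorff_image_def
    using average_eq[OF f_int k s]
  proof eventually_elim
    case (elim x)
    have fA: "(\<lambda>u. f (A u x)) \<in> borel_measurable M"
      using measurable_compose[OF orbit_measurable fm] by simp
    show ?case
      using elim integrable_norm_density_iff[OF \<Phi>m fA] integral_norm_density_sgn[OF \<Phi>m fA]
      by (simp add: g_def hausdorff_op_def)
  qed
  moreover have "g \<in> Lp_set p \<nu>" "Lp_norm p \<nu> g \<le> (LINT u|M. norm (\<Phi> u)) * Lp_norm p \<nu> f"
    using average_Lp[OF fL p k s] unfolding mass g_def by auto
  moreover have "fourier_coeff \<nu> g \<gamma> = 0" if \<gamma>: "\<gamma> \<in> characters - positive_cone r" for \<gamma>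
    unfolding fourier_coeff_def g_def
  proof (rule average_pairing_zero[OF f_int k s])
    show "(\<lambda>x. cnj (\<gamma> x)) \<in> borel_measurable borel"
      using \<gamma> by (intro borel_measurable_continuous_onI continuous_on_cnj) (simp add: characters_def)
    show "norm (cnj (\<gamma> x)) \<le> 1" for x using \<gamma> by (simp add: characters_def)
    have "AE u in M. 0 < ennreal (norm (\<Phi> u)) \<longrightarrow> (LINT x|\<nu>. f (A u x) * cnj (\<gamma> x)) = 0"
      using A(2)
    proof eventually_elim
      case (elim u)
      from fourier_coeff_compose_plus[OF elim f \<gamma>] show ?case by (simp add: fourier_coeff_def)
    qed
    then show "AE u in ?m. (LINT x|\<nu>. f (A u x) * cnj (\<gamma> x)) = 0"
      using \<Phi>m by (subst AE_density) auto
  qed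
  ultimately show ?thesis by (intro bexI[of _ g]) (auto simp: Hp_set_def)
qed

theorem corollary2:
  fixes \<nu> :: "'g::{topological_ab_group_add,t2_space} measure"
    and r :: "(('g \<Rightarrow> complex) \<times> ('g \<Rightarrow> complex)) set"
    and M :: "'w measure"
    and A :: "'w \<Rightarrow> 'g \<Rightarrow> 'g"
    and \<Phi> :: "'w \<Rightarrow> complex"
    and p :: ennreal
  assumes "compact (UNIV :: 'g set)"
    and "connected (UNIV :: 'g set)"
    and "normalized_haar \<nu>"
    and "character_order r"
    and "aut_measurable M A"
    and "AE u in M. A u \<in> top_auts_plus r"
    and "locally_integrable M \<Phi>"
    and "1 \<le> p"
  shows "(hausdorff_bounded \<nu> M \<Phi> A (Hp_set p \<nu> r) (Lp_norm p \<nu>) \<longleftrightarrow> integrable M \<Phi>) \<and>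
         (hausdorff_bounded \<nu> M \<Phi> A (Hp_set p \<nu> r) (Lp_norm p \<nu>) \<longrightarrow>
            hausdorff_norm \<nu> M \<Phi> A (Hp_set p \<nu> r) (Lp_norm p \<nu>) \<le> (LINT u|M. norm (\<Phi> u)))"
proof -
  have \<nu>: "compact_haar \<nu>" using assms(1,3) by (rule normalized_haar_compact_haar)
  interpret compact_haar \<nu> by (rule \<nu>)
  let ?Y = "Hp_set p \<nu> r" and ?N = "Lp_norm p \<nu>"
  let ?C = "LINT u|M. norm (\<Phi> u)"
  have necessary: "integrable M \<Phi>" if bounded: "hausdorff_bounded \<nu> M \<Phi> A ?Y ?N"
  proof -
    obtain g where "hausdorff_image \<nu> M \<Phi> A (\<lambda>_. 1) g"
      using bounded one_in_Hp[OF assms(4), of p] unfolding hausdorff_bounded_def by blast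
    then have "AE x in \<nu>. integrable M \<Phi>" unfolding hausdorff_image_def by eventually_elim simp
    then show ?thesis by simp
  qed
  have Y_meas: "f \<in> borel_measurable \<nu>" if "f \<in> ?Y" for f
    using that by (simp add: Hp_set_def Lp_set_def)
  have image: "\<exists>g\<in>?Y. hausdorff_image \<nu> M \<Phi> A f g" if "integrable M \<Phi>" "f \<in> ?Y" for f
    using hausdorff_integrable_bounds[OF \<nu> assms(5,6) that(1) assms(8) that(2)] by blast
  have bound: "?N g \<le> ?C * ?N f"
    if fg: "integrable M \<Phi>" "f \<in> ?Y" "g \<in> ?Y" "hausdorff_image \<nu> M \<Phi> A f g" for f g
  proof -
    obtain g' where g': "g' \<in> ?Y" "hausdorff_image \<nu> M \<Phi> A f g'" "?N g' \<le> ?C * ?N f"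
      using hausdorff_integrable_bounds[OF \<nu> assms(5,6) fg(1) assms(8) fg(2)] by blast
    have "AE x in \<nu>. g x = g' x"
      using fg(4) g'(2) unfolding hausdorff_image_def by eventually_elim simp
    with g'(3) Lp_norm_cong_AE[OF Y_meas[OF fg(3)] Y_meas[OF g'(1)]] show ?thesis by simp
  qed
  have sufficient: "hausdorff_bounded \<nu> M \<Phi> A ?Y ?N" if "integrable M \<Phi>"
    unfolding hausdorff_bounded_def using image[OF that] bound[OF that] by blast
  have "hausdorff_norm \<nu> M \<Phi> A ?Y ?N \<le> ?C" if int: "integrable M \<Phi>"
    unfolding hausdorff_norm_def
  proof (rule cSup_least)
    have "(\<lambda>_. 0) \<in> ?Y" using zero_in_Lp by (simp add: Hp_set_def fourier_coeff_def)
    moreover from image[OF int this]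
    obtain g where "g \<in> ?Y" "hausdorff_image \<nu> M \<Phi> A (\<lambda>_. 0) g" by blast
    moreover have "?N (\<lambda>_. 0) \<le> 1" using Lp_norm_zero[of p] by simp
    ultimately show "{?N g |f g. f \<in> ?Y \<and> g \<in> ?Y \<and> ?N f \<le> 1 \<and> hausdorff_image \<nu> M \<Phi> A f g} \<noteq> {}"
      by blast
  next
    fix t assume "t \<in> {?N g |f g. f \<in> ?Y \<and> g \<in> ?Y \<and> ?N f \<le> 1 \<and> hausdorff_image \<nu> M \<Phi> A f g}"
    then obtain f g where "t = ?N g" "f \<in> ?Y" "g \<in> ?Y" "?N f \<le> 1" "hausdorff_image \<nu> M \<Phi> A f g" by blast
    then have "t \<le> ?C * ?N f" using bound[OF int] by simp
    also have "\<dots> \<le> ?C * 1" by (intro mult_left_mono \<open>?N f \<le> 1\<close>) (simp add: integral_nonneg_AE)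
    finally show "t \<le> ?C" by simp
  qed
  with necessary sufficient show ?thesis by blast
qed

end
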